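(* Let $g$ be a derivator, $\mathbb F\in\{\mathbb R,\mathbb C\}$, $k\in\mathbb N$, and let $(x_i)_{i=0}^k$ be a sequence of points in $\mathbb R_+$ ordered from left to right ($g(x_0)\le g(x_1)\le\cdots\le g(x_k)$) with associated multiplicities $m_i\in\mathbb N$, $i\in\{0,\dots,k\}$. Set $n=k+\sum_{j=0}^km_j$, let $y_0\in\mathbb R_+$ and $t_{r,j}\in\mathbb F$ for $r\in\{0,\dots,k\}$, $j\in\{0,\dots,m_r\}$. Then the following are equivalent: I. The Hermite* interpolation problem $$\operatorname{L}_{y_0}\operatorname{D}^{j}(\lambda)(x_r)=t_{r,j},\qquad j\in\{0,\dots,m_r\},\ r\in\{0,\dots,k\},$$ has a unique solution $\lambda\in\mathbb F^{n+1}$. II. $\#g([x_i,x_{i+1}]^g_+)\ge m_i+2$ for all $i\in\{0,\dots,k-1\}$.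
   Context: $\mathbb N=\{0,1,2,\dots\}$; $\#$ denotes cardinality. A derivator is a left-continuous nondecreasing function $g:\mathbb R\to\mathbb R$; $\mu_g$ is the Lebesgue–Stieltjes measure with $\mu_g([a,b))=g(b)-g(a)$. $g(t^+)$ is the right-hand limit and $D_g=\{t\in\mathbb R:g(t^+)>g(t)\}$. $\mathbb R_+$ is the disjoint union of $\mathbb R$ and a formal copy $\{t^+:t\in D_g\}$ of $D_g$; $g$ is extended to $\mathbb R_+$ by letting $g(t^+)$ be the right-hand limit of $g$ at $t$. For $x,y\in\mathbb R_+$, $[x,y]^g_+=\{z\in\mathbb R_+:g(x)\le g(z)\le g(y)\}$, and $g(A)=\{g(z):z\in A\}$. Put $\int_x^y f\,d\mu_g=\int_{[x,y)}f\,d\mu_g$ if $y\ge x$ and $-\int_{[y,x)}f\,d\mu_g$ if $y<x$. For $r\in\mathbb R$ the $g$-monomials are $g_{r,0}(x)=1$, $g_{r,m}(x)=m\int_{r}^xg_{r,m-1}\,d\mu_g$ ($m\ge1$), $x\in\mathbb R$. They are extended to centers and arguments in $\mathbb R_+$ by continuity: for $t\in D_g$, $g_{t^+,m}(x)=\lim_{r\to t^+}g_{r,m}(x)$ for $x\in\mathbb R$, and for $r\in\mathbb R_+$ and $u\in D_g$, $g_{r,m}(u^+)=\lim_{x\to u^+}g_{r,m}(x)$. For $y_0\in\mathbb R_+$ and $\lambda=(\lambda_0,\dots,\lambda_n)\in\mathbb F^{n+1}$, $\operatorname{L}_{y_0}(\lambda)=\sum_{m=0}^n\lambda_mg_{y_0,m}$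 (a function on $\mathbb R_+$), and $\operatorname{D}:\mathbb F^{n+1}\to\mathbb F^{n+1}$ is the linear map $\operatorname{D}(\lambda_0,\dots,\lambda_n)=(\lambda_1,2\lambda_2,\dots,n\lambda_n,0)$. *)

theory Defs
  imports "HOL-Analysis.Analysis" "Jordan_Normal_Form.Matrix"
begin

(* Let $ denote the entries of vectors of Jordan_Normal_Form only. *)
unbundle no vec_syntax

definition derivator :: "(real \<Rightarrow> real) \<Rightarrow> bool" where
  "derivator g \<longleftrightarrow> mono g \<and> (\<forall>t. continuous (at_left t) g)"

(* The measure on the Borel sets with mu_g [a,b) = g b - g a. This is interval_measure with
   the half-open intervals reversed, because g is continuous from the left; see
   emeasure_LS_measure below. *)
definition LS_measure :: "(real \<Rightarrow> real) \<Rightarrow> real measure" where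
  "LS_measure g =
     extend_measure UNIV {(a, b). a \<le> b} (\<lambda>(a, b). {a..<b}) (\<lambda>(a, b). ennreal (g b - g a))"

definition jump_points :: "(real \<Rightarrow> real) \<Rightarrow> real set" where
  "jump_points g = {t. Lim (at_right t) g > g t}"

(* Right t is the formal point t^+; it belongs to R_+ only if t is a jump point of g. *)
datatype xpoint = Point real | Right real

definition Rplus :: "(real \<Rightarrow> real) \<Rightarrow> xpoint set" where
  "Rplus g = range Point \<union> Right ` jump_points g"

(* Extension of a real function to R_+; only meaningful where the right-hand limit exists. *)
fun ext_plus :: "(real \<Rightarrow> real) \<Rightarrow> xpoint \<Rightarrow> real" where
  "ext_plus f (Point t) = f t"
| "ext_plus f (Right t) = Lim (at_right t) f"

definition interval_plus :: "(real \<Rightarrow> real) \<Rightarrow> xpoint \<Rightarrow> xpoint \<Rightarrow> xpoint set" where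
  "interval_plus g x y =
     {z \<in> Rplus g. ext_plus g x \<le> ext_plus g z \<and> ext_plus g z \<le> ext_plus g y}"

definition LS_integral :: "(real \<Rightarrow> real) \<Rightarrow> real \<Rightarrow> real \<Rightarrow> (real \<Rightarrow> real) \<Rightarrow> real" where
  "LS_integral g x y f =
     (if x \<le> y then LINT s:{x..<y}|LS_measure g. f s
      else - (LINT s:{y..<x}|LS_measure g. f s))"

primrec gmonom_real :: "(real \<Rightarrow> real) \<Rightarrow> nat \<Rightarrow> real \<Rightarrow> real \<Rightarrow> real" where
  "gmonom_real g 0 r x = 1"
| "gmonom_real g (Suc m) r x = real (Suc m) * LS_integral g r x (gmonom_real g m r)"

(* The centre is extended first, at every real argument, and then the argument. *)
definition gmonom :: "(real \<Rightarrow> real) \<Rightarrow> nat \<Rightarrow> xpoint \<Rightarrow> xpoint \<Rightarrow> real" where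
  "gmonom g m r x = ext_plus (\<lambda>y. ext_plus (\<lambda>s. gmonom_real g m s y) r) x"

(* An element of F^(n+1) is a vector in carrier_vec (n + 1), with entries numbered from 0. *)
definition Lop :: "(real \<Rightarrow> real) \<Rightarrow> xpoint \<Rightarrow> 'a::real_field Matrix.vec \<Rightarrow> xpoint \<Rightarrow> 'a" where
  "Lop g y\<^sub>0 l x = (\<Sum>m<dim_vec l. l $ m * of_real (gmonom g m y\<^sub>0 x))"

definition Dop :: "'a::real_field Matrix.vec \<Rightarrow> 'a Matrix.vec" where
  "Dop l = Matrix.vec (dim_vec l)
     (\<lambda>i. if Suc i < dim_vec l then of_nat (Suc i) * l $ Suc i else 0)"

definition hermite_star_solution ::
  "(real \<Rightarrow> real) \<Rightarrow> nat \<Rightarrow> (nat \<Rightarrow> xpoint) \<Rightarrow> (nat \<Rightarrow> nat) \<Rightarrow> xpoint \<Rightarrow>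
   (nat \<Rightarrow> nat \<Rightarrow> 'a::real_field) \<Rightarrow> 'a Matrix.vec \<Rightarrow> bool" where
  "hermite_star_solution g k x m y\<^sub>0 t l \<longleftrightarrow>
     (\<forall>r\<le>k. \<forall>j\<le>m r. Lop g y\<^sub>0 ((Dop ^^ j) l) (x r) = t r j)"

(* card is 0 on infinite sets, hence the case distinction. *)
definition card_at_least :: "'a set \<Rightarrow> nat \<Rightarrow> bool" where
  "card_at_least A c \<longleftrightarrow> infinite A \<or> c \<le> card A"

lemma sets_LS_measure: "sets (LS_measure g) = sets borel"
proof -
  have "sigma_sets UNIV ((\<lambda>(a, b). {a..<b}) ` {(a, b). a \<le> b}) = sets (borel :: real measure)"
  proof (intro equalityI)
    show "sigma_sets UNIV ((\<lambda>(a, b). {a..<b}) ` {(a, b). a \<le> b}) \<subseteq> sets (borel :: real measure)"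
      using sets.sigma_sets_subset[of "(\<lambda>(a, b). {a..<b}) ` {(a, b). a \<le> b}" "borel :: real measure"]
      by (auto simp: subset_eq)
    have "sets (borel :: real measure) = sigma_sets UNIV (range (\<lambda>(a, b). {a..<b}))"
      unfolding borel_eq_atLeastLessThan by (rule sets_measure_of) simp
    also have "\<dots> \<subseteq> sigma_sets UNIV ((\<lambda>(a, b). {a..<b}) ` {(a, b). a \<le> b})"
    proof (rule sigma_sets_mono, safe)
      fix a b :: real
      show "{a..<b} \<in> sigma_sets UNIV ((\<lambda>(a, b). {a..<b}) ` {(a, b). a \<le> b})"
      proof (cases "a \<le> b")
        case True
        then show ?thesis by (intro sigma_sets.Basic) auto
      next
        case False
        then show ?thesis by (simp add: sigma_sets.Empty)
      qed
    qed
    finally show "sets (borel :: real measure)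
        \<subseteq> sigma_sets UNIV ((\<lambda>(a, b). {a..<b}) ` {(a, b). a \<le> b})" .
  qed
  then show ?thesis
    by (simp add: LS_measure_def sets_extend_measure)
qed

lemma emeasure_LS_measure:
  assumes g: "derivator g" and ab: "a \<le> b"
  shows "emeasure (LS_measure g) {a..<b} = ennreal (g b - g a)"
proof -
  define F where "F x = - g (- x)" for x
  define N where "N = distr (interval_measure F) borel uminus"
  have mono: "F x \<le> F y" if "x \<le> y" for x y
    using g that by (auto simp: F_def derivator_def mono_def)
  have cont: "continuous (at_right x) F" for x
  proof -
    have "(g \<longlongrightarrow> g (- x)) (at_left (- x))"
      using g by (auto simp: derivator_def continuous_within)
    then have "((\<lambda>y. g (- y)) \<longlongrightarrow> g (- x)) (at_right x)"
      unfolding filterlim_at_left_to_right by simp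
    then show ?thesis
      unfolding F_def continuous_within by (intro tendsto_minus)
  qed
  have N: "emeasure N {c..<d} = ennreal (g d - g c)" if "c \<le> d" for c d
  proof -
    have "emeasure N {c..<d} = emeasure (interval_measure F) (uminus -` {c..<d})"
      unfolding N_def by (subst emeasure_distr) auto
    also have "uminus -` {c..<d} = {- d<..- c}"
      by auto
    also have "emeasure (interval_measure F) {- d<..- c} = ennreal (F (- c) - F (- d))"
      using that by (intro emeasure_interval_measure_Ioc mono cont) auto
    also have "F (- c) - F (- d) = g d - g c"
      by (simp add: F_def)
    finally show ?thesis .
  qed
  have "sets N = sets (LS_measure g)"
    by (simp add: N_def sets_LS_measure)
  then show ?thesis
    using emeasure_extend_measure_Pair[OF LS_measure_def[of g], of "emeasure N" a b] N ab
      emeasure_positive[of N] emeasure_countably_additive[of N]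
    by auto
qed

end

theory Submission
  imports Defs "Jordan_Normal_Form.Determinant"
begin

text \<open>Since there are as many conditions as coefficients, I holds iff the homogeneous real problem has
  only the trivial solution. For $f_j = L_{y_0} D^j(\lambda)$ one has
  $f_j(y) - f_j(x) = \int_{[x,y)} f_{j+1}\,d\mu_g$, hence a mean value theorem for consecutive $f_j$.
  As in the Budan-Fourier theorem, consider the number $V(x)$ of sign changes in the sequence
  $((-1)^j f_j(x))_j$. It is nondecreasing in $x$, and if $f_0, \dots, f_{m_i}$ vanish at $x_i$, it
  grows by at least $m_i + 1$ on $[x_i, x_{i+1}]$ as soon as $g$ takes $m_i + 2$ values there. At $x_k$ the
  first $m_k + 1$ entries vanish, which leaves room for at most $n - m_k - 1$ sign changes of a nonzero
  sequence, one less than the total growth $\sum_{i<k} (m_i + 1) = n - m_k$. Conversely, if $g$ takes at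
  most $m_i + 1$ values on $[x_i, x_{i+1}]$, the interval consists of at most $m_i$ jumps, and the
  vanishing of $f_0, \dots, f_{m_i}$ at $x_i$ forces $f_0(x_{i+1}) = 0$.\<close>

section \<open>Sign changes\<close>

text \<open>The obstacle is that the f_j may jump: they can change sign without vanishing, and two
  zeros of f_j only force f_{j+1} to take values \<le> 0 and \<ge> 0 in between. The count therefore
  compares whole sign patterns at two points, and a Rolle step occurs only where f_{j+1} keeps its
  sign. The factors (-1)^j make h(x) - h(y) the integral over [x,y) of the next entry: while that
  entry keeps its sign, h moves away from it, so an existing change persists and zeros at the front
  turn into changes to the right. Continuity is replaced by parity: the last nonzero entry is
  constant, so equally many changes at two points force the same leading sign.

  Leading zeros act as a reserve. V plus their number is nondecreasing as well, and each strict
  increase of g gains at least one change as long as the sequence starts with a zero. A gain of m_i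
  + 1 obtained one at a time takes m_i + 1 increases, hence m_i + 2 values of g.\<close>

primrec lead :: "real list \<Rightarrow> real" where
  "lead [] = 0"
| "lead (a # as) = (if a \<noteq> 0 then a else lead as)"

text \<open>Comparing with \<open>lead as\<close> instead of the next entry makes zeros invisible;
  the last nonzero entry meets the default 0 and counts nothing.\<close>

primrec sign_changes :: "real list \<Rightarrow> nat" where
  "sign_changes [] = 0"
| "sign_changes (a # as) = sign_changes as + (if a * lead as < 0 then 1 else 0)"

primrec leading_zeros :: "real list \<Rightarrow> nat" where
  "leading_zeros [] = 0"
| "leading_zeros (a # as) = (if a = 0 then Suc (leading_zeros as) else 0)"

lemma lead_eq_0_iff: "lead as = 0 \<longleftrightarrow> (\<forall>a\<in>set as. a = 0)"
  by (induction as) auto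

lemma sign_changes_eq_0: "lead as = 0 \<Longrightarrow> sign_changes as = 0"
  by (induction as) (auto split: if_splits)

text \<open>A change is counted at its left entry, which is nonzero, and the last nonzero entry
  starts none. This is the bound on the available room at the last node.\<close>

lemma sign_changes_plus_leading_zeros:
  "lead as \<noteq> 0 \<Longrightarrow> sign_changes as + leading_zeros as < length as"
proof (induction as)
  case (Cons a as)
  show ?case
  proof (cases "lead as = 0")
    case True
    with Cons.prems have "a \<noteq> 0" by auto
    then show ?thesis using True sign_changes_eq_0[OF True] by auto
  next
    case False
    then show ?thesis using Cons.IH by auto
  qed
qed simp

lemma leading_zeros_ge:
  "m \<le> length as \<Longrightarrow> (\<And>j. j < m \<Longrightarrow> as ! j = 0) \<Longrightarrow> m \<le> leading_zeros as"
proof (induction as arbitrary: m)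
  case (Cons a as)
  show ?case
  proof (cases m)
    case (Suc m')
    have "a = 0" using Cons.prems(2)[of 0] Suc by simp
    moreover have "m' \<le> leading_zeros as"
      using Cons.IH[of m'] Cons.prems(1) Cons.prems(2)[of "Suc _"] Suc by fastforce
    ultimately show ?thesis using Suc by simp
  qed simp
qed simp

text \<open>The signed parity of the number of sign changes is the sign of the last nonzero entry.\<close>

definition end_sign :: "real list \<Rightarrow> real" where
  "end_sign as = sgn (lead as) * (- 1) ^ sign_changes as"

text \<open>A new nonzero entry flips the sign of \<open>lead\<close> exactly when it adds a change,
  so the two effects cancel.\<close>

lemma end_sign_Cons: "end_sign (a # as) = (if lead as = 0 then sgn a else end_sign as)"
proof (cases "lead as = 0")
  case True
  then show ?thesis by (simp add: end_sign_def sign_changes_eq_0)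
next
  case False
  consider "a = 0" | "a \<noteq> 0" "a * lead as < 0" | "a \<noteq> 0" "a * lead as > 0"
    using False by (metis linorder_neqE_linordered_idom mult_eq_0_iff)
  then show ?thesis
  proof cases
    case 2
    then have "sgn a = - sgn (lead as)" by (auto simp: mult_less_0_iff)
    then show ?thesis using 2 False by (simp add: end_sign_def)
  next
    case 3
    then have "sgn a = sgn (lead as)" by (auto simp: zero_less_mult_iff)
    then show ?thesis using 3 False by (simp add: end_sign_def)
  qed (simp add: end_sign_def False)
qed

lemma sgn_mult_less_0_iff: "sgn b * a < 0 \<longleftrightarrow> a * b < 0" for a b :: real
  by (auto simp: sgn_real_def mult_less_0_iff)

lemma end_sign_eq_0_iff: "end_sign as = 0 \<longleftrightarrow> lead as = 0"
  by (simp add: end_sign_def sgn_zero_iff)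

section \<open>Sign changes along chains of functions with mean values\<close>

locale graded_points =
  fixes X :: "'p set" and G :: "'p \<Rightarrow> real"
begin

text \<open>All that the zero count needs from an identity $h(x) - h(y) = \int_{[x,y)} h_1\,d\mu$
  is the mean value theorem.\<close>

definition neg_deriv :: "('p \<Rightarrow> real) \<Rightarrow> ('p \<Rightarrow> real) \<Rightarrow> bool" where
  "neg_deriv h h1 \<longleftrightarrow> (\<forall>x\<in>X. \<forall>y\<in>X.
     (G x = G y \<longrightarrow> h x = h y) \<and>
     (G x < G y \<longrightarrow>
       (\<exists>w\<in>X. G x \<le> G w \<and> G w < G y \<and> h1 w * (G y - G x) \<le> h x - h y) \<and>
       (\<exists>w\<in>X. G x \<le> G w \<and> G w < G y \<and> h x - h y \<le> h1 w * (G y - G x))))"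

text \<open>The default for the empty tail makes the last function constant on \<open>X\<close>, as
  the highest derivative of a combination of monomials is.\<close>

primrec tower :: "('p \<Rightarrow> real) list \<Rightarrow> bool" where
  "tower [] \<longleftrightarrow> True"
| "tower (h # hs) \<longleftrightarrow> neg_deriv h (if hs = [] then \<lambda>_. 0 else hd hs) \<and> tower hs"

primrec vals :: "('p \<Rightarrow> real) list \<Rightarrow> 'p \<Rightarrow> real list" where
  "vals [] x = []"
| "vals (h # hs) x = h x # vals hs x"

lemma vals_conv_map: "vals hs x = map (\<lambda>h. h x) hs"
  by (induction hs) auto

lemma neg_deriv_cong:
  assumes "neg_deriv h h1" "x \<in> X" "y \<in> X" "G x = G y"
  shows "h x = h y"
  using assms unfolding neg_deriv_def by blast

text \<open>The derivative enters with reversed sign, so growth of \<open>s * h\<close> needs a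
  negative value of \<open>s * h1\<close>; the factor \<open>s\<close> covers growth and decay of
  \<open>h\<close> at once.\<close>

lemma neg_deriv_sign:
  assumes h: "neg_deriv h h1" and xy: "x \<in> X" "y \<in> X" "G x \<le> G y" and s: "s * h x < s * h y"
  obtains w where "w \<in> X" "G x \<le> G w" "G w < G y" "s * h1 w < 0"
proof -
  have lt: "G x < G y"
    using neg_deriv_cong[OF h xy(1,2)] xy(3) s by fastforce
  obtain w w' where w: "w \<in> X" "G x \<le> G w" "G w < G y" "h1 w * (G y - G x) \<le> h x - h y"
    and w': "w' \<in> X" "G x \<le> G w'" "G w' < G y" "h x - h y \<le> h1 w' * (G y - G x)"
    using h xy lt unfolding neg_deriv_def by blast
  show thesis
  proof (cases "s > 0")
    case True
    with s have "h x - h y < 0" by simp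
    with w(4) lt have "h1 w < 0" by (smt (verit) mult_nonneg_nonneg)
    with True show thesis by (intro that[OF w(1,2,3)]) (simp add: mult_pos_neg)
  next
    case False
    with s have "s < 0" by (cases "s = 0") auto
    with s have "h x - h y > 0" by simp
    with w'(4) lt have "h1 w' > 0" by (smt (verit) mult_nonneg_nonneg mult_minus_left)
    with \<open>s < 0\<close> show thesis by (intro that[OF w'(1,2,3)]) (simp add: mult_neg_pos)
  qed
qed

text \<open>What is left of Rolle's theorem without continuity: equal end values give one value of
  \<open>h1\<close> that is \<le> 0 and one that is \<ge> 0, and the sign condition forces one of
  them to be 0.\<close>

lemma neg_deriv_zero:
  assumes h: "neg_deriv h h1" and xy: "x \<in> X" "y \<in> X" "G x < G y" and eq: "h x = h y"
    and s: "s \<noteq> 0" "\<And>w. w \<in> X \<Longrightarrow> G x \<le> G w \<Longrightarrow> G w < G y \<Longrightarrow> s * h1 w \<ge> 0"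
  obtains w where "w \<in> X" "G x \<le> G w" "G w < G y" "h1 w = 0"
proof -
  obtain w w' where w: "w \<in> X" "G x \<le> G w" "G w < G y" "h1 w * (G y - G x) \<le> h x - h y"
    and w': "w' \<in> X" "G x \<le> G w'" "G w' < G y" "h x - h y \<le> h1 w' * (G y - G x)"
    using h xy unfolding neg_deriv_def by blast
  have "h1 w \<le> 0" "h1 w' \<ge> 0"
    using w(4) w'(4) eq xy(3) by (auto simp: mult_le_0_iff zero_le_mult_iff)
  moreover have "s * h1 w \<ge> 0" "s * h1 w' \<ge> 0" using s(2) w w' by auto
  ultimately have "h1 w = 0 \<or> h1 w' = 0"
    using s(1) by (auto simp: zero_le_mult_iff)
  then show thesis using that w w' by blast
qed

text \<open>If the tail vanishes at one point, the induction hypothesis makes it vanish everywhere;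
  then \<open>h\<close> has zero derivative and is constant, and its sign is the end sign.\<close>

lemma end_sign_const:
  "tower hs \<Longrightarrow> x \<in> X \<Longrightarrow> y \<in> X \<Longrightarrow> end_sign (vals hs x) = end_sign (vals hs y)"
proof (induction hs arbitrary: x y)
  case (Cons h hs)
  show ?case
  proof (cases "lead (vals hs x) = 0")
    case False
    moreover have "end_sign (vals hs x) = end_sign (vals hs y)"
      using Cons.prems by (intro Cons.IH) auto
    ultimately show ?thesis using end_sign_eq_0_iff[of "vals hs y"] end_sign_eq_0_iff[of "vals hs x"]
      by (simp add: end_sign_Cons)
  next
    case True
    have zero: "lead (vals hs w) = 0" if "w \<in> X" for w
    proof -
      have "end_sign (vals hs x) = end_sign (vals hs w)"
        by (rule Cons.IH) (use Cons.prems that in simp_all)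
      then show ?thesis using True end_sign_eq_0_iff by metis
    qed
    define h1 where "h1 = (if hs = [] then \<lambda>_. 0 else hd hs)"
    have h1: "h1 w = 0" if "w \<in> X" for w
      using zero[OF that] by (cases hs) (auto simp: h1_def split: if_splits)
    have h: "neg_deriv h h1" using Cons.prems by (simp add: h1_def)
    have le: "h p = h q" if pq: "p \<in> X" "q \<in> X" "G p \<le> G q" for p q
    proof (rule ccontr)
      assume "h p \<noteq> h q"
      then have "1 * h p < 1 * h q \<or> - 1 * h p < - 1 * h q" by auto
      then obtain s where s: "s * h p < s * h q" by blast
      obtain w where "w \<in> X" "s * h1 w < 0"
        by (rule neg_deriv_sign[OF h pq s])
      then show False using h1 by simp
    qed
    have "h x = h y" using le[of x y] le[of y x] Cons.prems by linarith
    then show ?thesis using zero Cons.prems by (simp add: end_sign_Cons)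
  qed
qed simp

lemma lead_eq_0_const:
  assumes "tower hs" "x \<in> X" "y \<in> X" "lead (vals hs x) = 0"
  shows "lead (vals hs y) = 0"
  using assms(4) unfolding end_sign_eq_0_iff[symmetric] end_sign_const[OF assms(1-3)] .

text \<open>The constant end sign is the leading sign times the parity of the number of changes.
  This takes the place of following a sign continuously from \<open>x\<close> to
  \<open>y\<close>.\<close>

lemma sgn_lead_eq:
  assumes "tower hs" "x \<in> X" "y \<in> X" "sign_changes (vals hs x) = sign_changes (vals hs y)"
  shows "sgn (lead (vals hs x)) = sgn (lead (vals hs y))"
  using end_sign_const[OF assms(1-3)] unfolding end_sign_def assms(4) by simp

text \<open>Only the loss of the change at the head could do harm, and only if the tail gains
  nothing. Then the leading sign \<open>s\<close> of the tail is the same at all points between, so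
  \<open>h\<close> can only move away from \<open>s\<close>, and its sign opposite to
  \<open>s\<close> survives.\<close>

lemma sign_changes_mono:
  "tower hs \<Longrightarrow> x \<in> X \<Longrightarrow> y \<in> X \<Longrightarrow> G x \<le> G y \<Longrightarrow>
    sign_changes (vals hs x) \<le> sign_changes (vals hs y)"
proof (induction hs arbitrary: x y)
  case (Cons h hs)
  have IH: "sign_changes (vals hs p) \<le> sign_changes (vals hs q)"
    if "p \<in> X" "q \<in> X" "G p \<le> G q" for p q
    by (rule Cons.IH) (use Cons.prems that in simp_all)
  have le: "sign_changes (vals hs x) \<le> sign_changes (vals hs y)" by (rule IH[OF Cons.prems(2-4)])
  show ?case
  proof (cases "h x * lead (vals hs x) < 0 \<and> sign_changes (vals hs x) = sign_changes (vals hs y)")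
    case False
    then show ?thesis using le by auto
  next
    case True
    define s where "s = sgn (lead (vals hs x))"
    have s: "sgn (lead (vals hs w)) = s" if "w \<in> X" "G x \<le> G w" "G w \<le> G y" for w
    proof -
      have "sign_changes (vals hs x) = sign_changes (vals hs w)"
        using IH[of x w] IH[of w y] that Cons.prems True by simp
      then show ?thesis using sgn_lead_eq[of hs x w] that Cons.prems by (simp add: s_def)
    qed
    have hs: "hs \<noteq> []" using True by auto
    have neg: "neg_deriv h (hd hs)" using Cons.prems hs by simp
    have "s * h x < 0"
      using True by (simp add: s_def sgn_mult_less_0_iff)
    moreover have "\<not> s * h x < s * h y"
    proof
      assume less: "s * h x < s * h y"
      obtain w where w: "w \<in> X" "G x \<le> G w" "G w < G y" "s * hd hs w < 0"
        by (rule neg_deriv_sign[OF neg Cons.prems(2-4) less])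
      have "hd hs w \<noteq> 0" using w(4) by auto
      then have "lead (vals hs w) = hd hs w" using hs by (cases hs) auto
      then have "sgn (hd hs w) = s" using s[of w] w by simp
      with w(4) show False 
        using sgn_mult_less_0_iff[of "hd hs w" "hd hs w"] not_square_less_zero by simp
    qed
    ultimately have "s * h y < 0" by simp
    then have "h y * lead (vals hs y) < 0"
      using s[OF Cons.prems(3,4) order_refl] sgn_mult_less_0_iff[of "lead (vals hs y)" "h y"] by simp
    then show ?thesis using le by simp
  qed
qed simp

text \<open>The critical case is a zero of \<open>h\<close> at \<open>x\<close> that is gone at
  \<open>y\<close>. Leaving 0 requires a point \<open>w\<close> where the derivative is nonzero with
  sign opposite to \<open>h y\<close>. At \<open>w\<close> the tail has no leading zeros, so by
  induction all those at \<open>x\<close> have become changes; the head adds one more at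
  \<open>y\<close>, unless the tail has gained one itself.\<close>

lemma sign_changes_plus_leading_zeros_mono:
  "tower hs \<Longrightarrow> x \<in> X \<Longrightarrow> y \<in> X \<Longrightarrow> G x \<le> G y \<Longrightarrow>
    sign_changes (vals hs x) + leading_zeros (vals hs x)
      \<le> sign_changes (vals hs y) + leading_zeros (vals hs y)"
proof (induction hs arbitrary: x y)
  case (Cons h hs)
  let ?W = "\<lambda>x. sign_changes (vals hs x) + leading_zeros (vals hs x)"
  have IH: "?W p \<le> ?W q" if "p \<in> X" "q \<in> X" "G p \<le> G q" for p q
    by (rule Cons.IH) (use Cons.prems that in simp_all)
  show ?case
  proof (cases "h x = 0")
    case False
    then show ?thesis using sign_changes_mono[OF Cons.prems] by simp
  next
    case hx: True
    show ?thesis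
    proof (cases "h y = 0")
      case True
      then show ?thesis using hx IH Cons.prems by simp
    next
      case False
      define h1 where "h1 = (if hs = [] then \<lambda>_. 0 else hd hs)"
      have neg: "neg_deriv h h1" using Cons.prems by (simp add: h1_def)
      define s where "s = sgn (h y)"
      have less: "s * h x < s * h y" 
        using False hx by (cases "h y" "0::real" rule: linorder_cases) (auto simp: s_def)
      obtain w where w: "w \<in> X" "G x \<le> G w" "G w < G y" "s * h1 w < 0"
        by (rule neg_deriv_sign[OF neg Cons.prems(2-4) less])
      have hs: "hs \<noteq> []" and hw: "hd hs w \<noteq> 0" using w(4) by (auto simp: h1_def split: if_splits)
      have lw: "lead (vals hs w) = hd hs w" and zw: "leading_zeros (vals hs w) = 0"
        using hs hw by (cases hs; simp)+
      have le: "sign_changes (vals hs w) \<le> sign_changes (vals hs y)"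
        using sign_changes_mono[of hs w y] w Cons.prems by simp
      have "Suc (sign_changes (vals hs w)) \<le> sign_changes (vals (h # hs) y)"
      proof (cases "sign_changes (vals hs w) = sign_changes (vals hs y)")
        case True
        then have "sgn (lead (vals hs y)) = sgn (hd hs w)"
          using sgn_lead_eq[of hs w y] w Cons.prems lw by simp
        then have "h y * lead (vals hs y) < 0"
          using w(4) hs by (metis s_def h1_def sgn_mult_less_0_iff mult.commute)
        then show ?thesis using True by simp
      next
        case False
        then show ?thesis using le by simp
      qed
      moreover have "?W x \<le> sign_changes (vals hs w)"
        using IH[of x w] w Cons.prems zw by simp
      ultimately show ?thesis using hx False by simp
    qed
  qed
qed simp

text \<open>If \<open>h y\<close> is nonzero, the reserve of leading zeros at \<open>x\<close> has
  been spent by the previous monotonicity. If \<open>h\<close> vanishes at both ends and the tail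
  gained nothing, the derivative would keep its sign on [x,y) and hence vanish at some
  \<open>w\<close> there; the induction hypothesis from \<open>w\<close> to \<open>y\<close> then
  yields a gain after all.\<close>

lemma sign_changes_strict:
  "tower hs \<Longrightarrow> x \<in> X \<Longrightarrow> y \<in> X \<Longrightarrow> G x < G y \<Longrightarrow> lead (vals hs x) \<noteq> 0 \<Longrightarrow> hd hs x = 0 \<Longrightarrow>
    sign_changes (vals hs x) < sign_changes (vals hs y)"
proof (induction hs arbitrary: x y)
  case (Cons h hs)
  have hx: "h x = 0" and lx: "lead (vals hs x) \<noteq> 0" using Cons.prems by (auto split: if_splits)
  have hs: "hs \<noteq> []" using lx by auto
  have ly: "lead (vals hs w) \<noteq> 0" if "w \<in> X" for w
    using lead_eq_0_const[of hs w x] that lx Cons.prems by auto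
  have tow: "tower hs" using Cons.prems by simp
  have le: "sign_changes (vals hs p) \<le> sign_changes (vals hs q)"
    if "p \<in> X" "q \<in> X" "G p \<le> G q" for p q
    using sign_changes_mono[OF tow that] .
  have IH: "sign_changes (vals hs p) < sign_changes (vals hs q)"
    if "p \<in> X" "q \<in> X" "G p < G q" "hd hs p = 0" for p q
    using Cons.IH[OF tow that(1-3) ly[OF that(1)] that(4)] .
  show ?case
  proof (cases "h y = 0")
    case False
    have "sign_changes (vals (h # hs) x) + leading_zeros (vals (h # hs) x)
      \<le> sign_changes (vals (h # hs) y) + leading_zeros (vals (h # hs) y)"
      using sign_changes_plus_leading_zeros_mono[OF Cons.prems(1-3)] Cons.prems(4) by simp
    then show ?thesis using False hx by simp
  next
    case hy: True
    have "sign_changes (vals hs x) < sign_changes (vals hs y)"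
    proof (rule ccontr)
      assume "\<not> ?thesis"
      then have eq: "sign_changes (vals hs x) = sign_changes (vals hs y)"
        using le[of x y] Cons.prems by simp
      define s where "s = sgn (lead (vals hs x))"
      have s: "s * hd hs w \<ge> 0" if "w \<in> X" "G x \<le> G w" "G w < G y" for w
      proof (cases "hd hs w = 0")
        case False
        then have "lead (vals hs w) = hd hs w" using hs by (cases hs) auto
        moreover have "sign_changes (vals hs x) = sign_changes (vals hs w)"
          using le[of x w] le[of w y] that Cons.prems eq by simp
        ultimately have "sgn (hd hs w) = s"
          using sgn_lead_eq[of hs x w] that Cons.prems by (simp add: s_def)
        then show ?thesis by (metis sgn_mult_less_0_iff not_square_less_zero not_less)
      qed simp
      have neg: "neg_deriv h (hd hs)" using Cons.prems hs by simp
      have s0: "s \<noteq> 0" using lx by (simp add: s_def sgn_zero_iff)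
      have hxy: "h x = h y" using hx hy by simp
      obtain w where w: "w \<in> X" "G x \<le> G w" "G w < G y" "hd hs w = 0"
        by (rule neg_deriv_zero[OF neg Cons.prems(2-4) hxy s0 s])
      show False using IH[OF w(1) Cons.prems(3) w(3,4)] le[OF Cons.prems(2) w(1,2)] eq by simp
    qed
    then show ?thesis using hx hy by simp
  qed
qed simp

text \<open>Induction over the values of \<open>G\<close>, from the second largest one to
  \<open>y\<close>. If no leading zero is left there, all of them have already become changes;
  otherwise the last step gains one more.\<close>

lemma sign_changes_grow:
  assumes "tower hs" "lead (vals hs x) \<noteq> 0" "x \<in> X"
  shows "y \<in> X \<Longrightarrow> finite A \<Longrightarrow> card A = Suc c \<Longrightarrow> A \<subseteq> G ` {z \<in> X. G x \<le> G z \<and> G z \<le> G y} \<Longrightarrow>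
    sign_changes (vals hs x) + min c (leading_zeros (vals hs x)) \<le> sign_changes (vals hs y)"
proof (induction c arbitrary: y A)
  case 0
  then obtain a where "a \<in> A" by fastforce
  then have "G x \<le> G y" using 0 by fastforce
  then show ?case using sign_changes_mono[OF assms(1,3) 0(1)] by simp
next
  case (Suc c)
  define B where "B = A - {Max A}"
  have Ane: "A \<noteq> {}" using Suc.prems by auto
  have B: "finite B" "card B = Suc c" using Suc.prems Ane by (auto simp: B_def)
  have Bne: "B \<noteq> {}" using B by auto
  have "Max B \<in> B" using B Bne by simp
  then have "Max B \<in> G ` {z \<in> X. G x \<le> G z \<and> G z \<le> G y}"
    using Suc.prems(4) unfolding B_def by (meson DiffD1 subsetD)
  then obtain z where z: "z \<in> X" "G x \<le> G z" "G z = Max B" by auto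
  have "Max B < Max A" using \<open>Max B \<in> B\<close> Suc.prems(2) unfolding B_def
    by (metis DiffE Max_ge insertI1 less_le)
  moreover have "Max A \<in> A" using Suc.prems(2) Ane by simp
  ultimately have zy: "G z < G y" using Suc.prems(4) z(3) by fastforce
  have "B \<subseteq> G ` {w \<in> X. G x \<le> G w \<and> G w \<le> G z}"
  proof
    fix b assume b: "b \<in> B"
    then have "b \<le> G z" unfolding z(3) by (rule Max_ge[OF B(1)])
    moreover have "b \<in> G ` {z \<in> X. G x \<le> G z \<and> G z \<le> G y}"
      using b Suc.prems(4) unfolding B_def by (meson DiffD1 subsetD)
    ultimately show "b \<in> G ` {w \<in> X. G x \<le> G w \<and> G w \<le> G z}" by auto
  qed
  then have IH: "sign_changes (vals hs x) + min c (leading_zeros (vals hs x)) \<le> sign_changes (vals hs z)"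
    using Suc.IH[OF z(1) B] by simp
  show ?case
  proof (cases "leading_zeros (vals hs z) = 0")
    case True
    have "sign_changes (vals hs x) + leading_zeros (vals hs x) \<le> sign_changes (vals hs z)"
      using sign_changes_plus_leading_zeros_mono[OF assms(1,3) z(1,2)] True by simp
    moreover have "sign_changes (vals hs z) \<le> sign_changes (vals hs y)"
      using sign_changes_mono[OF assms(1) z(1) Suc.prems(1)] zy by simp
    ultimately show ?thesis by simp
  next
    case False
    then have "hd hs z = 0" by (cases hs) (auto split: if_splits)
    moreover have "lead (vals hs z) \<noteq> 0" using lead_eq_0_const[OF assms(1) z(1) assms(3)] assms(2) by auto
    ultimately have "sign_changes (vals hs z) < sign_changes (vals hs y)"
      using sign_changes_strict[OF assms(1) z(1) Suc.prems(1) zy] by simp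
    then show ?thesis using IH by simp
  qed
qed

section \<open>From mean values to the zeros of a solution\<close>

definition has_mean_values :: "('p \<Rightarrow> real) \<Rightarrow> ('p \<Rightarrow> real) \<Rightarrow> bool" where
  "has_mean_values f f1 \<longleftrightarrow> (\<forall>x\<in>X. \<forall>y\<in>X.
     (G x = G y \<longrightarrow> f x = f y) \<and>
     (G x < G y \<longrightarrow>
       (\<exists>w\<in>X. G x \<le> G w \<and> G w < G y \<and> f1 w * (G y - G x) \<le> f y - f x) \<and>
       (\<exists>w\<in>X. G x \<le> G w \<and> G w < G y \<and> f y - f x \<le> f1 w * (G y - G x))))"

lemma has_mean_values_cong:
  assumes "has_mean_values f f1" "x \<in> X" "y \<in> X" "G x = G y"
  shows "f x = f y"
  using assms unfolding has_mean_values_def by blast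

lemma has_mean_valuesE:
  assumes "has_mean_values f f1" "x \<in> X" "y \<in> X" "G x < G y"
  obtains w w' where
    "w \<in> X" "G x \<le> G w" "G w < G y" "f1 w * (G y - G x) \<le> f y - f x"
    "w' \<in> X" "G x \<le> G w'" "G w' < G y" "f y - f x \<le> f1 w' * (G y - G x)"
  using assms unfolding has_mean_values_def by blast

lemma neg_deriv_alternate:
  assumes "has_mean_values f f1"
  shows "neg_deriv (\<lambda>z. (- 1) ^ j * f z) (\<lambda>z. (- 1) ^ Suc j * f1 z)"
  unfolding neg_deriv_def
proof (intro ballI conjI impI)
  fix x y assume xy: "x \<in> X" "y \<in> X"
  show "(- 1) ^ j * f x = (- 1) ^ j * f y" if "G x = G y"
    using has_mean_values_cong[OF assms xy that] by simp
  assume less: "G x < G y"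
  obtain w w' where w: "w \<in> X" "G x \<le> G w" "G w < G y" "f1 w * (G y - G x) \<le> f y - f x"
    and w': "w' \<in> X" "G x \<le> G w'" "G w' < G y" "f y - f x \<le> f1 w' * (G y - G x)"
    by (rule has_mean_valuesE[OF assms xy less])
  have sgn: "(- 1) ^ j = (1 :: real) \<or> (- 1) ^ j = (- 1 :: real)"
    by (cases "even j") auto
  from sgn show "\<exists>w\<in>X. G x \<le> G w \<and> G w < G y \<and>
      (- 1) ^ Suc j * f1 w * (G y - G x) \<le> (- 1) ^ j * f x - (- 1) ^ j * f y"
  proof
    assume "(- 1) ^ j = (1 :: real)"
    with w' show ?thesis by (intro bexI[of _ w']) (simp_all add: algebra_simps)
  next
    assume "(- 1) ^ j = (- 1 :: real)"
    with w show ?thesis by (intro bexI[of _ w]) (simp_all add: algebra_simps)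
  qed
  from sgn show "\<exists>w\<in>X. G x \<le> G w \<and> G w < G y \<and>
      (- 1) ^ j * f x - (- 1) ^ j * f y \<le> (- 1) ^ Suc j * f1 w * (G y - G x)"
  proof
    assume "(- 1) ^ j = (1 :: real)"
    with w show ?thesis by (intro bexI[of _ w]) (simp_all add: algebra_simps)
  next
    assume "(- 1) ^ j = (- 1 :: real)"
    with w' show ?thesis by (intro bexI[of _ w']) (simp_all add: algebra_simps)
  qed
qed

lemma tower_alternate:
  assumes f: "\<And>j. has_mean_values (f j) (f (Suc j))" and n: "\<And>z. f (Suc n) z = 0"
  shows "i \<le> Suc n \<Longrightarrow> tower (map (\<lambda>j z. (- 1) ^ j * f j z) [i..<Suc n])"
proof (induction rule: inc_induct)
  case (step i)
  have upt: "[i..<Suc n] = i # [Suc i..<Suc n]" using step(2) by (simp add: upt_conv_Cons)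
  have "neg_deriv (\<lambda>z. (- 1) ^ i * f i z)
    (if map (\<lambda>j z. (- 1) ^ j * f j z) [Suc i..<Suc n] = [] then \<lambda>_. 0
     else hd (map (\<lambda>j z. (- 1) ^ j * f j z) [Suc i..<Suc n]))"
  proof (cases "i = n")
    case True
    then show ?thesis using neg_deriv_alternate[OF f, of i i] n by simp
  next
    case False
    then have "[Suc i..<Suc n] = Suc i # [Suc (Suc i)..<Suc n]"
      using step(2) by (simp add: upt_conv_Cons)
    then show ?thesis using neg_deriv_alternate[OF f, of i i] by simp
  qed
  then show ?case using step.IH unfolding upt by (simp del: upt_Suc)
qed simp

lemma interpolation_kernel_trivial:
  assumes f: "\<And>j. has_mean_values (f j) (f (Suc j))" and vanish: "\<And>j z. j > n \<Longrightarrow> f j z = 0"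
    and x: "\<And>i. i \<le> k \<Longrightarrow> x i \<in> X" and n: "n = k + (\<Sum>j\<le>k. m j)"
    and many: "\<And>i. i < k \<Longrightarrow>
      card_at_least (G ` {z \<in> X. G (x i) \<le> G z \<and> G z \<le> G (x (Suc i))}) (m i + 2)"
    and zeros: "\<And>r j. r \<le> k \<Longrightarrow> j \<le> m r \<Longrightarrow> f j (x r) = 0"
    and z: "z \<in> X"
  shows "f j z = 0"
proof -
  define hs where "hs = map (\<lambda>j z. (- 1) ^ j * f j z) [0..<Suc n]"
  have tow: "tower hs"
    using tower_alternate[of f n 0, OF f] vanish by (simp add: hs_def)
  have vals: "vals hs w = map (\<lambda>j. (- 1) ^ j * f j w) [0..<Suc n]" for w
    by (simp add: vals_conv_map hs_def del: upt_Suc)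
  have len: "length (vals hs w) = Suc n" for w
    by (simp add: vals del: upt_Suc)
  have nth: "vals hs w ! i = (- 1) ^ i * f i w" if "i \<le> n" for i w
    using that by (simp add: vals nth_map del: upt_Suc)
  have lz: "Suc (m r) \<le> leading_zeros (vals hs (x r))" if r: "r \<le> k" for r
  proof (rule leading_zeros_ge)
    have "m r \<le> (\<Sum>j\<le>k. m j)" using r by (intro member_le_sum) auto
    then show "Suc (m r) \<le> length (vals hs (x r))" using n len by simp
    then show "vals hs (x r) ! j = 0" if "j < Suc (m r)" for j
      using that zeros[OF r, of j] len nth[of j "x r"] by simp
  qed
  have "lead (vals hs (x 0)) = 0"
  proof (rule ccontr)
    assume "lead (vals hs (x 0)) \<noteq> 0"
    then have ne: "lead (vals hs (x r)) \<noteq> 0" if "r \<le> k" for r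
      using lead_eq_0_const[OF tow x[OF that] x[of 0]] by auto
    have "(\<Sum>i<r. Suc (m i)) \<le> sign_changes (vals hs (x r))" if "r \<le> k" for r
      using that
    proof (induction r)
      case (Suc r)
      let ?B = "G ` {z \<in> X. G (x r) \<le> G z \<and> G z \<le> G (x (Suc r))}"
      have "\<exists>A. finite A \<and> card A = Suc (Suc (m r)) \<and> A \<subseteq> ?B"
      proof (cases "finite ?B")
        case True
        then have "Suc (Suc (m r)) \<le> card ?B"
          using many[of r] Suc.prems by (auto simp: card_at_least_def)
        then obtain A where "A \<subseteq> ?B" "card A = Suc (Suc (m r))" "finite A"
          by (rule obtain_subset_with_card_n)
        then show ?thesis by blast
      next
        case False
        then show ?thesis by (rule infinite_arbitrarily_large)
      qed
      then obtain A where A: "finite A" "card A = Suc (Suc (m r))" "A \<subseteq> ?B" by blast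
      \<comment> \<open>Here \<open>m r + 2\<close> values mean \<open>m r + 1\<close> steps, and
        there are at least as many leading zeros, so the minimum is \<open>m r + 1\<close>.\<close>
      have "sign_changes (vals hs (x r)) + min (Suc (m r)) (leading_zeros (vals hs (x r)))
          \<le> sign_changes (vals hs (x (Suc r)))"
        using Suc.prems x ne by (intro sign_changes_grow[OF tow _ _ _ A]) auto
      then show ?case using Suc lz[of r] by simp
    qed simp
    then have "(\<Sum>i<k. Suc (m i)) \<le> sign_changes (vals hs (x k))" by simp
    moreover have "sign_changes (vals hs (x k)) + leading_zeros (vals hs (x k)) < Suc n"
      using sign_changes_plus_leading_zeros[OF ne[of k]] len by simp
    moreover have "Suc (m k) \<le> leading_zeros (vals hs (x k))" using lz by simp
    moreover have "(\<Sum>i<k. Suc (m i)) + Suc (m k) = Suc n"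
      using n by (simp add: sum_Suc lessThan_Suc_atMost[symmetric])
    ultimately show False by linarith
  qed
  then have zero: "lead (vals hs z) = 0"
    using lead_eq_0_const[OF tow x[of 0] z] by simp
  show ?thesis
  proof (cases "j \<le> n")
    case True
    then have "vals hs z ! j = 0" using zero len[of z] by (simp add: lead_eq_0_iff)
    then show ?thesis using nth[OF True] by simp
  qed (use vanish in simp)
qed

text \<open>A gap with too few values of $G$ consists of jumps only, across which each zero costs one
  derivative.\<close>

lemma zeros_propagate:
  assumes f: "\<And>j. has_mean_values (f j) (f (Suc j))" and xy: "x \<in> X" "y \<in> X" "G x \<le> G y"
    and fin: "finite (G ` {z \<in> X. G x \<le> G z \<and> G z \<le> G y})"
    and card: "card (G ` {z \<in> X. G x \<le> G z \<and> G z \<le> G y}) \<le> Suc p"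
    and zeros: "\<And>q. q \<le> p \<Longrightarrow> f q x = 0"
  shows "f 0 y = 0"
proof -
  let ?B = "\<lambda>y. G ` {z \<in> X. G x \<le> G z \<and> G z \<le> G y}"
  \<comment> \<open>Strengthened for the induction: after \<open>c\<close> values of
    \<open>G\<close>, the zeros of order at most \<open>p - (c - 1)\<close> survive. The claim is
    the case \<open>q = 0\<close>.\<close>
  have "f q y = 0" if "y \<in> X" "G x \<le> G y" "finite (?B y)" "card (?B y) \<le> Suc (p - q)" "q \<le> p" for y q
    using that
  proof (induction "card (?B y)" arbitrary: y q rule: less_induct)
    case less
    show ?case
    proof (cases "G x = G y")
      case True
      then show ?thesis
        using has_mean_values_cong[OF f[of q] xy(1) less.prems(1)] less.prems(5) zeros[of q] by simp
    next
      case False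
      then have less': "G x < G y" using less.prems by simp
      define v where "v = Max (?B y - {G y})"
      have "G x \<in> ?B y - {G y}" using xy(1) less' by auto
      then have "v \<in> ?B y - {G y}"
        unfolding v_def using less.prems(3) by (intro Max_in) auto
      then obtain z where z: "z \<in> X" "G x \<le> G z" "G z < G y" "G z = v" by auto
      have gap: "G w \<le> G z" if "w \<in> X" "G x \<le> G w" "G w < G y" for w
        unfolding z(4) v_def using that less.prems(3) by (intro Max_ge) auto
      have sub: "?B z \<subseteq> ?B y - {G y}" using z(3) by auto
      have "G y \<in> ?B y" using less.prems less' by auto
      then have card: "card (?B y - {G y}) < card (?B y)"
        using less.prems(3) by (intro psubset_card_mono) auto
      have fin: "finite (?B z)" using sub less.prems(3) finite_subset by blast
      have le: "card (?B z) \<le> card (?B y - {G y})"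
        using sub less.prems(3) by (intro card_mono) auto
      have pos: "card (?B z) > 0" using fin z by (auto simp: card_gt_0_iff)
      have "q < p" using le card pos less.prems(4) by linarith
      have small: "card (?B z) < card (?B y)" using le card by simp
      have z0: "f q z = 0" and z1: "f (Suc q) z = 0"
        using less.hyps[OF small z(1,2) fin, of q] less.hyps[OF small z(1,2) fin, of "Suc q"]
          small less.prems(4) \<open>q < p\<close> by auto
      obtain w w' where w: "w \<in> X" "G z \<le> G w" "G w < G y" "f (Suc q) w * (G y - G z) \<le> f q y - f q z"
        and w': "w' \<in> X" "G z \<le> G w'" "G w' < G y" "f q y - f q z \<le> f (Suc q) w' * (G y - G z)"
        by (rule has_mean_valuesE[OF f[of q] z(1) less.prems(1) z(3)])
      \<comment> \<open>No value of \<open>G\<close> lies strictly between those of \<open>z\<close>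
        and \<open>y\<close>, so both mean value points carry the derivative at \<open>z\<close>,
        which is 0.\<close>
      have "G w = G z" "G w' = G z" using gap[of w] gap[of w'] w w' z(2) by auto
      then have "f (Suc q) w = 0" "f (Suc q) w' = 0"
        using has_mean_values_cong[OF f[of "Suc q"] w(1) z(1)]
          has_mean_values_cong[OF f[of "Suc q"] w'(1) z(1)] z1 by simp_all
      then show ?thesis using w(4) w'(4) z0 by simp
    qed
  qed
  from this[of y 0] show ?thesis using xy fin card by simp
qed

end

section \<open>The interpolation matrix\<close>

text \<open>A kernel vector could be added to any solution, and a nonzero determinant gives Cramer's
  solution through the adjugate; hence \<open>b\<close> is absent from the right-hand side.\<close>

lemma ex1_linear_system_iff:
  fixes A :: "'a::field mat"
  assumes A: "A \<in> carrier_mat N N" and b: "b \<in> carrier_vec N"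
  shows "(\<exists>!l. l \<in> carrier_vec N \<and> A *\<^sub>v l = b) \<longleftrightarrow> det A \<noteq> 0"
proof
  assume ex1: "\<exists>!l. l \<in> carrier_vec N \<and> A *\<^sub>v l = b"
  then obtain l where l: "l \<in> carrier_vec N" "A *\<^sub>v l = b" by blast
  show "det A \<noteq> 0"
  proof
    assume "det A = 0"
    then obtain v where v: "v \<in> carrier_vec N" "v \<noteq> 0\<^sub>v N" "A *\<^sub>v v = 0\<^sub>v N"
      using det_0_iff_vec_prod_zero_field[OF A] by blast
    have "A *\<^sub>v (l + v) = b"
      using mult_add_distrib_mat_vec[OF A l(1) v(1)] l(2) v(3) b by simp
    moreover have "l + v \<in> carrier_vec N" using l v by simp
    ultimately have eq: "l + v = l" using ex1 l by blast
    have "v = 0\<^sub>v N"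
    proof (rule eq_vecI)
      fix i assume i: "i < dim_vec (0\<^sub>v N)"
      have "(l + v) $ i = l $ i" using eq by simp
      then show "v $ i = 0\<^sub>v N $ i" using i v(1) by simp
    qed (use v(1) in simp)
    with v(2) show False by simp
  qed
next
  assume det: "det A \<noteq> 0"
  define l where "l = (1 / det A) \<cdot>\<^sub>v (adj_mat A *\<^sub>v b)"
  have adj: "adj_mat A \<in> carrier_mat N N" using adj_mat(1)[OF A] .
  have "A *\<^sub>v l = (1 / det A) \<cdot>\<^sub>v ((A * adj_mat A) *\<^sub>v b)"
    unfolding l_def using A adj b by (simp add: mult_mat_vec assoc_mult_mat_vec[OF A adj b])
  also have "\<dots> = b"
    unfolding adj_mat(2)[OF A] using b det
    by (intro eq_vecI) (auto simp: scalar_prod_def sum.remove[of "{0..<N}"] if_distrib cong: if_cong)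
  finally have l: "A *\<^sub>v l = b" .
  have lc: "l \<in> carrier_vec N" using adj b by (simp add: l_def)
  show "\<exists>!l. l \<in> carrier_vec N \<and> A *\<^sub>v l = b"
  proof (rule ex1I[of _ l])
    fix l' assume l': "l' \<in> carrier_vec N \<and> A *\<^sub>v l' = b"
    have "A *\<^sub>v (l' - l) = 0\<^sub>v N"
      using mult_minus_distrib_mat_vec[OF A, of l' l] l' l lc b by simp
    moreover have "l' - l \<in> carrier_vec N" using l' lc by simp
    ultimately have zero: "l' - l = 0\<^sub>v N" using det det_0_iff_vec_prod_zero_field[OF A] by blast
    show "l' = l"
    proof (rule eq_vecI)
      fix i assume i: "i < dim_vec l"
      have "(l' - l) $ i = 0\<^sub>v N $ i" using zero by simp
      then show "l' $ i = l $ i" using i lc l' by simp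
    qed (use l' lc in simp)
  qed (use l lc in simp)
qed

text \<open>The contribution of the c-th unit vector to the j-th condition at \<open>z\<close>. The
  quotient \<open>gmonom / fact\<close> stays together because the monomials divided by factorials
  are successive derivatives of each other.\<close>

definition gmonom_deriv :: "(real \<Rightarrow> real) \<Rightarrow> xpoint \<Rightarrow> nat \<Rightarrow> xpoint \<Rightarrow> nat \<Rightarrow> real" where
  "gmonom_deriv g y\<^sub>0 j z c =
     (if j \<le> c then fact c * (gmonom g (c - j) y\<^sub>0 z / fact (c - j)) else 0)"

lemma gmonom_deriv_Suc:
  "gmonom_deriv g y\<^sub>0 (Suc j) z (Suc c) = real (Suc c) * gmonom_deriv g y\<^sub>0 j z c"
  "gmonom_deriv g y\<^sub>0 (Suc j) z 0 = 0"
  by (simp_all add: gmonom_deriv_def)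

lemma Lop_Dop_power:
  "Lop g y\<^sub>0 ((Dop ^^ j) l) z = (\<Sum>c<dim_vec l. l $ c * of_real (gmonom_deriv g y\<^sub>0 j z c))"
proof (induction j arbitrary: l)
  case 0
  then show ?case by (simp add: Lop_def gmonom_deriv_def)
next
  case (Suc j)
  have "Lop g y\<^sub>0 ((Dop ^^ Suc j) l) z
      = (\<Sum>c<dim_vec l. Dop l $ c * of_real (gmonom_deriv g y\<^sub>0 j z c))"
    unfolding funpow_Suc_right comp_def Suc.IH by (simp add: Dop_def)
  also have "\<dots> = (\<Sum>c<dim_vec l. l $ c * of_real (gmonom_deriv g y\<^sub>0 (Suc j) z c))"
  proof (cases "dim_vec l")
    case (Suc N)
    have "(\<Sum>c<Suc N. Dop l $ c * of_real (gmonom_deriv g y\<^sub>0 j z c))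
        = (\<Sum>c<N. l $ Suc c * of_real (gmonom_deriv g y\<^sub>0 (Suc j) z (Suc c)))"
      using Suc by (simp add: Dop_def gmonom_deriv_Suc mult_ac)
    also have "\<dots> = (\<Sum>c<Suc N. l $ c * of_real (gmonom_deriv g y\<^sub>0 (Suc j) z c))"
      by (simp only: sum.lessThan_Suc_shift gmonom_deriv_Suc(2)) simp
    finally show ?thesis using Suc by simp
  qed simp
  finally show ?case .
qed

lemma hermite_star_solution_conv_system:
  fixes l :: "'a::real_field Matrix.vec"
  assumes e: "bij_betw e {..<N} (SIGMA r:{..k}. {..m r})"
    and A: "A = mat N N (\<lambda>(i, c). gmonom_deriv g y\<^sub>0 (snd (e i)) (x (fst (e i))) c)"
    and l: "l \<in> carrier_vec N"
  shows "hermite_star_solution g k x m y\<^sub>0 t l \<longleftrightarrow>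
    map_mat of_real A *\<^sub>v l = Matrix.vec N (\<lambda>i. t (fst (e i)) (snd (e i)))"
proof -
  let ?I = "SIGMA r:{..k}. {..m r}"
  have row: "(map_mat of_real A *\<^sub>v l) $ i = Lop g y\<^sub>0 ((Dop ^^ snd (e i)) l) (x (fst (e i)))"
    if i: "i < N" for i
    using i l by (simp add: A Lop_Dop_power scalar_prod_def atLeast0LessThan mult.commute)
  have "hermite_star_solution g k x m y\<^sub>0 t l \<longleftrightarrow>
      (\<forall>p\<in>?I. Lop g y\<^sub>0 ((Dop ^^ snd p) l) (x (fst p)) = t (fst p) (snd p))"
    by (auto simp: hermite_star_solution_def)
  also have "\<dots> \<longleftrightarrow> (\<forall>i<N. (map_mat of_real A *\<^sub>v l) $ i = t (fst (e i)) (snd (e i)))"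
    unfolding bij_betw_imp_surj_on[OF e, symmetric] using row by auto
  also have "\<dots> \<longleftrightarrow> map_mat of_real A *\<^sub>v l = Matrix.vec N (\<lambda>i. t (fst (e i)) (snd (e i)))"
    by (auto simp: vec_eq_iff A)
  finally show ?thesis .
qed

text \<open>The matrix is real and \<open>of_real\<close> commutes with the determinant, so one real
  determinant decides for every choice of field and data.\<close>

lemma hermite_star_solution_ex1_iff:
  fixes t :: "nat \<Rightarrow> nat \<Rightarrow> 'a::real_field"
  assumes N: "N = (\<Sum>r\<le>k. Suc (m r))"
  shows "(\<exists>!l. l \<in> carrier_vec N \<and> hermite_star_solution g k x m y\<^sub>0 t l) \<longleftrightarrow>
    (\<forall>l :: real Matrix.vec. l \<in> carrier_vec N \<longrightarrow>
       hermite_star_solution g k x m y\<^sub>0 (\<lambda>_ _. 0) l \<longrightarrow> l = 0\<^sub>v N)"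
proof -
  let ?I = "SIGMA r:{..k}. {..m r}"
  have "card ?I = N" using N by simp
  moreover have "finite ?I" by simp
  ultimately obtain e where e: "bij_betw e {..<N} ?I"
    using ex_bij_betw_nat_finite[of ?I] by (auto simp: atLeast0LessThan)
  define A where "A = mat N N (\<lambda>(i, c). gmonom_deriv g y\<^sub>0 (snd (e i)) (x (fst (e i))) c)"
  note sys = hermite_star_solution_conv_system[OF e A_def]
  have A: "A \<in> carrier_mat N N" by (simp add: A_def)
  have A_real: "map_mat of_real A = A" by (intro eq_matI) auto
  have "(\<exists>!l. l \<in> carrier_vec N \<and> hermite_star_solution g k x m y\<^sub>0 t l) \<longleftrightarrow>
      (\<exists>!l. l \<in> carrier_vec N \<and>
        map_mat of_real A *\<^sub>v l = Matrix.vec N (\<lambda>i. t (fst (e i)) (snd (e i))))"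
    using sys[of _ t] by (simp cong: conj_cong)
  also have "\<dots> \<longleftrightarrow> det (map_mat of_real A :: 'a mat) \<noteq> 0"
    using A by (intro ex1_linear_system_iff) auto
  also have "\<dots> \<longleftrightarrow> det A \<noteq> 0"
    by (simp add: of_real_hom.hom_det)
  also have "\<dots> \<longleftrightarrow> (\<forall>l :: real Matrix.vec. l \<in> carrier_vec N \<longrightarrow>
      hermite_star_solution g k x m y\<^sub>0 (\<lambda>_ _. 0) l \<longrightarrow> l = 0\<^sub>v N)"
  proof -
    have "hermite_star_solution g k x m y\<^sub>0 (\<lambda>_ _. 0) l \<longleftrightarrow> A *\<^sub>v l = 0\<^sub>v N"
      if "l \<in> carrier_vec N" for l
      using sys[OF that, of "\<lambda>_ _. 0"] unfolding A_real zero_vec_def .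
    then show ?thesis unfolding det_0_iff_vec_prod_zero_field[OF A] by blast
  qed
  finally show ?thesis .
qed

section \<open>Integration against $\mu_g$\<close>

text \<open>This class contains all functions that occur and is closed under indefinite integration; its members
  are Borel measurable, locally bounded and have right-hand limits.\<close>

definition monotone_difference :: "(real \<Rightarrow> real) \<Rightarrow> bool" where
  "monotone_difference f \<longleftrightarrow> (\<exists>a b. mono a \<and> mono b \<and> f = (\<lambda>s. a s - b s))"

lemma monotone_differenceI: "mono a \<Longrightarrow> mono b \<Longrightarrow> monotone_difference (\<lambda>s. a s - b s)"
  unfolding monotone_difference_def by blast

lemma monotone_differenceE:
  assumes "monotone_difference f"
  obtains a b where "mono a" "mono b" "f = (\<lambda>s. a s - b s)"
  using assms unfolding monotone_difference_def by blast

lemma monotone_difference_mono: "mono f \<Longrightarrow> monotone_difference f"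
  using monotone_differenceI[of f "\<lambda>_. 0"] by (simp add: mono_def)

lemma monotone_difference_const: "monotone_difference (\<lambda>_. c)"
  by (rule monotone_difference_mono) (simp add: mono_def)

lemma monotone_difference_add:
  assumes "monotone_difference f" "monotone_difference h"
  shows "monotone_difference (\<lambda>s. f s + h s)"
proof -
  obtain a b where f: "mono a" "mono b" "f = (\<lambda>s. a s - b s)"
    by (rule monotone_differenceE[OF assms(1)])
  obtain c d where h: "mono c" "mono d" "h = (\<lambda>s. c s - d s)"
    by (rule monotone_differenceE[OF assms(2)])
  have "monotone_difference (\<lambda>s. (a s + c s) - (b s + d s))"
    using f(1,2) h(1,2) by (intro monotone_differenceI) (auto simp: mono_def intro: add_mono)
  then show ?thesis unfolding f(3) h(3) by (simp add: algebra_simps)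
qed

lemma monotone_difference_cmult:
  assumes "monotone_difference f"
  shows "monotone_difference (\<lambda>s. c * f s)"
proof -
  obtain a b where f: "mono a" "mono b" "f = (\<lambda>s. a s - b s)"
    by (rule monotone_differenceE[OF assms])
  show ?thesis
  proof (cases "c \<ge> 0")
    case True
    then have "monotone_difference (\<lambda>s. c * a s - c * b s)"
      using f(1,2) by (intro monotone_differenceI) (auto simp: mono_def intro: mult_left_mono)
    then show ?thesis unfolding f(3) by (simp add: algebra_simps)
  next
    case False
    then have "monotone_difference (\<lambda>s. (- c) * b s - (- c) * a s)"
      using f(1,2) by (intro monotone_differenceI) (auto simp: mono_def intro: mult_left_mono_neg)
    then show ?thesis unfolding f(3) by (simp add: algebra_simps)
  qed
qed

lemma monotone_difference_minus: "monotone_difference f \<Longrightarrow> monotone_difference (\<lambda>s. - f s)"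
  using monotone_difference_cmult[of f "- 1"] by simp

lemma monotone_difference_sum:
  "(\<And>i. i \<in> I \<Longrightarrow> monotone_difference (f i)) \<Longrightarrow> monotone_difference (\<lambda>s. \<Sum>i\<in>I. f i s)"
  by (induction I rule: infinite_finite_induct)
    (auto intro: monotone_difference_add monotone_difference_const)

text \<open>Rests on max(a - b, 0) = max(a, b) - b; it splits integrands into positive and negative
  parts within the class.\<close>

lemma monotone_difference_max_0:
  assumes "monotone_difference f"
  shows "monotone_difference (\<lambda>s. max (f s) 0)"
proof -
  obtain a b where f: "mono a" "mono b" "f = (\<lambda>s. a s - b s)"
    by (rule monotone_differenceE[OF assms])
  have "mono (\<lambda>s. max (a s) (b s))"
  proof (rule monoI)
    fix x y :: real assume xy: "x \<le> y"
    show "max (a x) (b x) \<le> max (a y) (b y)"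
      using monoD[OF f(1) xy] monoD[OF f(2) xy] by (simp add: max_def)
  qed
  moreover have "(\<lambda>s. max (f s) 0) = (\<lambda>s. max (a s) (b s) - b s)"
    unfolding f(3) by (auto simp: max_def)
  ultimately show ?thesis using f(2) by (simp add: monotone_differenceI)
qed

lemma borel_measurable_monotone_difference:
  assumes "monotone_difference f"
  shows "f \<in> borel_measurable borel"
proof -
  obtain a b where f: "mono a" "mono b" "f = (\<lambda>s. a s - b s)"
    by (rule monotone_differenceE[OF assms])
  show ?thesis
    unfolding f(3) using f(1,2)[THEN borel_measurable_mono] by measurable
qed

lemma monotone_difference_bounded:
  assumes "monotone_difference f"
  obtains C where "\<And>s. c \<le> s \<Longrightarrow> s \<le> d \<Longrightarrow> \<bar>f s\<bar> \<le> C"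
proof -
  obtain a b where f: "mono a" "mono b" "f = (\<lambda>s. a s - b s)"
    by (rule monotone_differenceE[OF assms])
  have "\<bar>f s\<bar> \<le> \<bar>a c\<bar> + \<bar>a d\<bar> + \<bar>b c\<bar> + \<bar>b d\<bar>" if "c \<le> s" "s \<le> d" for s
    using monoD[OF f(1) that(1)] monoD[OF f(1) that(2)] monoD[OF f(2) that(1)] monoD[OF f(2) that(2)]
    unfolding f(3) by linarith
  then show thesis by (rule that)
qed

lemma mono_tendsto_at_right:
  fixes a :: "real \<Rightarrow> real"
  assumes "mono a"
  shows "(a \<longlongrightarrow> Inf (a ` {t<..})) (at_right t)"
proof (rule order_tendstoI)
  have bdd: "bdd_below (a ` {t<..})"
    using assms by (intro bdd_belowI[of _ "a t"]) (auto simp: mono_def)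
  fix y
  show "\<forall>\<^sub>F s in at_right t. y < a s" if "y < Inf (a ` {t<..})"
    using eventually_at_right_less[of t]
  proof eventually_elim
    case (elim s)
    then have "Inf (a ` {t<..}) \<le> a s" using bdd by (intro cInf_lower) auto
    with that show ?case by simp
  qed
  show "\<forall>\<^sub>F s in at_right t. a s < y" if less: "Inf (a ` {t<..}) < y"
  proof -
    obtain s\<^sub>0 where s\<^sub>0: "t < s\<^sub>0" "a s\<^sub>0 < y"
      using cInf_lessD[OF _ less] by auto
    have "\<forall>\<^sub>F s in at_right t. s < s\<^sub>0"
      using s\<^sub>0(1) eventually_at_right by auto
    then show ?thesis
    proof eventually_elim
      case (elim s)
      then show ?case using s\<^sub>0(2) assms by (smt (verit) monoD)
    qed
  qed
qed

lemma monotone_difference_tendsto_at_right: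
  assumes "monotone_difference f"
  shows "(f \<longlongrightarrow> Lim (at_right t) f) (at_right t)"
proof -
  obtain a b where f: "mono a" "mono b" "f = (\<lambda>s. a s - b s)"
    by (rule monotone_differenceE[OF assms])
  have "(f \<longlongrightarrow> Inf (a ` {t<..}) - Inf (b ` {t<..})) (at_right t)"
    unfolding f(3) by (intro tendsto_diff mono_tendsto_at_right f(1,2))
  then show ?thesis by (metis tendsto_Lim trivial_limit_at_right_real)
qed

lemma ext_plus_sum:
  assumes "\<And>i. i \<in> I \<Longrightarrow> monotone_difference (f i)"
  shows "ext_plus (\<lambda>s. \<Sum>i\<in>I. f i s) z = (\<Sum>i\<in>I. ext_plus (f i) z)"
proof (cases z)
  case (Right t)
  have "((\<lambda>s. \<Sum>i\<in>I. f i s) \<longlongrightarrow> (\<Sum>i\<in>I. Lim (at_right t) (f i))) (at_right t)"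
    using assms by (intro tendsto_sum monotone_difference_tendsto_at_right)
  then show ?thesis using Right by (simp add: tendsto_Lim)
qed simp

lemma ext_plus_cmult:
  assumes "monotone_difference f"
  shows "ext_plus (\<lambda>s. c * f s) z = c * ext_plus f z"
proof (cases z)
  case (Right t)
  have "((\<lambda>s. c * f s) \<longlongrightarrow> c * Lim (at_right t) f) (at_right t)"
    using assms by (intro tendsto_mult_left monotone_difference_tendsto_at_right)
  then show ?thesis using Right by (simp add: tendsto_Lim)
qed simp

section \<open>The Stieltjes measure and indefinite integrals\<close>

locale stieltjes =
  fixes g :: "real \<Rightarrow> real"
  assumes g: "derivator g"
begin

abbreviation "M \<equiv> LS_measure g"

lemma mono_g: "mono g" using g by (simp add: derivator_def)

lemma g_le: "x \<le> y \<Longrightarrow> g x \<le> g y" using mono_g by (simp add: mono_def)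

lemma sets_M [simp, measurable_cong]: "sets M = sets borel" by (rule sets_LS_measure)

lemma set_integrable_monotone_difference:
  assumes f: "monotone_difference f" and A: "A \<in> sets borel" "A \<subseteq> {a..b}"
  shows "set_integrable M A f"
proof -
  obtain C where C: "\<And>s. a \<le> s \<Longrightarrow> s \<le> b \<Longrightarrow> \<bar>f s\<bar> \<le> C"
    using monotone_difference_bounded[OF f] by blast
  have [measurable]: "f \<in> borel_measurable borel"
    by (rule borel_measurable_monotone_difference[OF f])
  \<comment> \<open>The measure is given on half-open intervals, so [a,b] is enlarged to the
    right.\<close>
  have "emeasure M {a..<b + 1} < \<infinity>"
  proof (cases "a \<le> b + 1")
    case True
    then show ?thesis by (simp add: emeasure_LS_measure[OF g])
  qed simp
  moreover have "emeasure M A \<le> emeasure M {a..<b + 1}"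
    using A by (intro emeasure_mono) auto
  ultimately have fin: "emeasure M A < \<infinity>" by (rule le_less_trans[rotated])
  have bound: "AE s in M. s \<in> A \<longrightarrow> norm (f s) \<le> C"
  proof (rule AE_I2, rule impI)
    fix s assume "s \<in> A"
    then have "a \<le> s" "s \<le> b" using A by auto
    then show "norm (f s) \<le> C" using C by simp
  qed
  show ?thesis
    unfolding set_integrable_def
    by (rule integrableI_bounded_set_indicator[OF _ _ fin bound]) (use A in simp_all)
qed

lemma set_integrable_atLeastLessThan:
  assumes "monotone_difference f"
  shows "set_integrable M {a..<b} f"
  by (rule set_integrable_monotone_difference[OF assms, of _ a b]) (auto simp: subset_eq)

lemma LINT_atLeastLessThan_split:
  assumes "monotone_difference f" "a \<le> b" "b \<le> c"
  shows "(LINT s:{a..<c}|M. f s) = (LINT s:{a..<b}|M. f s) + (LINT s:{b..<c}|M. f s)"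
proof -
  have "{a..<c} = {a..<b} \<union> {b..<c}" using assms by auto
  then show ?thesis
    using set_integral_Un[of "{a..<b}" "{b..<c}" M f] assms
      set_integrable_atLeastLessThan[OF assms(1)] by (simp add: disjoint_iff)
qed

lemma LS_integral_split:
  assumes "monotone_difference f"
  shows "LS_integral g a c f = LS_integral g a b f + LS_integral g b c f"
  using LINT_atLeastLessThan_split[OF assms, of a b c] LINT_atLeastLessThan_split[OF assms, of a c b]
    LINT_atLeastLessThan_split[OF assms, of b a c] LINT_atLeastLessThan_split[OF assms, of b c a]
    LINT_atLeastLessThan_split[OF assms, of c a b] LINT_atLeastLessThan_split[OF assms, of c b a]
  by (auto simp: LS_integral_def set_lebesgue_integral_def)

lemma LS_integral_cmult: "LS_integral g a b (\<lambda>s. c * f s) = c * LS_integral g a b f"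
  by (simp add: LS_integral_def)

lemma LS_integral_sum:
  assumes "finite I" "\<And>i. i \<in> I \<Longrightarrow> monotone_difference (f i)"
  shows "LS_integral g a b (\<lambda>s. \<Sum>i\<in>I. f i s) = (\<Sum>i\<in>I. LS_integral g a b (f i))"
  using assms
proof (induction I rule: finite_induct)
  case empty
  then show ?case by (simp add: LS_integral_def set_lebesgue_integral_def)
next
  case (insert i I)
  have int: "set_integrable M {p..<q} (f i)" "set_integrable M {p..<q} (\<lambda>s. \<Sum>i\<in>I. f i s)" for p q
    using insert.prems
    by (auto intro!: set_integrable_atLeastLessThan monotone_difference_sum)
  show ?case using insert int by (auto simp: LS_integral_def set_integral_add)
qed

text \<open>Integrals of nonnegative functions are monotone in the upper limit; the positive and
  negative parts of \<open>f\<close> supply the two monotone functions.\<close>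

lemma monotone_difference_LS_integral:
  assumes f: "monotone_difference f"
  shows "monotone_difference (\<lambda>x. LS_integral g r x f)"
proof -
  have mono: "mono (\<lambda>x. LS_integral g r x h)" if h: "monotone_difference h" "\<And>s. h s \<ge> 0" for h
  proof (rule monoI)
    fix x y :: real assume "x \<le> y"
    have "LS_integral g r y h = LS_integral g r x h + LS_integral g x y h"
      by (rule LS_integral_split[OF h(1)])
    moreover have "LS_integral g x y h \<ge> 0"
      using \<open>x \<le> y\<close> h(2) by (simp add: LS_integral_def set_lebesgue_integral_def)
    ultimately show "LS_integral g r x h \<le> LS_integral g r y h" by simp
  qed
  define p q where "p s = max (f s) 0" and "q s = max (- f s) 0" for s
  have p: "monotone_difference p" and q: "monotone_difference q"
    unfolding p_def q_def using f by (auto intro!: monotone_difference_max_0 monotone_difference_minus)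
  have int: "set_integrable M {a..<b} p" "set_integrable M {a..<b} q" for a b
    using p q by (auto intro: set_integrable_atLeastLessThan)
  have fpq: "f = (\<lambda>s. p s - q s)" by (auto simp: p_def q_def)
  have "LS_integral g r x f = LS_integral g r x p - LS_integral g r x q" for x
    unfolding fpq LS_integral_def using int by simp
  then show ?thesis
    using monotone_differenceI[OF mono[OF p] mono[OF q]] by (simp add: p_def q_def)
qed

text \<open>The difference \<open>left_part q - left_part p\<close> plays the role of [p,q) for
  extended points: ending at t^+ instead of t includes the atom at t.\<close>

fun left_part :: "xpoint \<Rightarrow> real set" where
  "left_part (Point t) = {..<t}"
| "left_part (Right t) = {..t}"

fun base :: "xpoint \<Rightarrow> real" where
  "base (Point t) = t"
| "base (Right t) = t"

lemma left_part_cases: "left_part p \<subseteq> left_part q \<or> left_part q \<subseteq> left_part p"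
  by (cases p; cases q) (auto simp: subset_eq)

lemma base_mono:
  assumes "left_part p \<subseteq> left_part q"
  shows "base p \<le> base q"
proof (rule ccontr)
  assume "\<not> base p \<le> base q"
  then obtain z where "base q < z" "z < base p" using dense not_le by blast
  then have "z \<in> left_part p" "z \<notin> left_part q" by (cases p; cases q; simp)+
  with assms show False by blast
qed

definition primitive :: "(real \<Rightarrow> real) \<Rightarrow> (real \<Rightarrow> real) \<Rightarrow> bool" where
  "primitive f f1 \<longleftrightarrow> monotone_difference f \<and> monotone_difference f1 \<and>
     (\<forall>x y. x \<le> y \<longrightarrow> f y - f x = (LINT s:{x..<y}|M. f1 s))"

lemma primitiveD: "primitive f f1 \<Longrightarrow> x \<le> y \<Longrightarrow> f y - f x = (LINT s:{x..<y}|M. f1 s)"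
  by (simp add: primitive_def)

lemma primitive_g: "primitive g (\<lambda>_. 1)"
proof -
  have "g y - g x = (LINT s:{x..<y}|M. 1)" if "x \<le> y" for x y
    using that emeasure_LS_measure[OF g that] g_le[OF that]
    by (simp add: set_lebesgue_integral_def measure_def)
  then show ?thesis
    unfolding primitive_def using monotone_difference_mono[OF mono_g] monotone_difference_const by auto
qed

lemma primitive_const: "primitive (\<lambda>_. c) (\<lambda>_. 0)"
  by (simp add: primitive_def monotone_difference_const set_lebesgue_integral_def)

lemma primitive_cmult:
  assumes "primitive f f1"
  shows "primitive (\<lambda>s. c * f s) (\<lambda>s. c * f1 s)"
proof -
  have "c * f y - c * f x = (LINT s:{x..<y}|M. c * f1 s)" if "x \<le> y" for x y
    using assms that by (simp add: primitive_def right_diff_distrib[symmetric])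
  then show ?thesis using assms unfolding primitive_def by (auto intro: monotone_difference_cmult)
qed

lemma primitive_minus: "primitive f f1 \<Longrightarrow> primitive (\<lambda>s. - f s) (\<lambda>s. - f1 s)"
  using primitive_cmult[of f f1 "- 1"] by simp

lemma primitive_add:
  assumes "primitive f f1" "primitive h h1"
  shows "primitive (\<lambda>s. f s + h s) (\<lambda>s. f1 s + h1 s)"
proof -
  have "(f y + h y) - (f x + h x) = (LINT s:{x..<y}|M. f1 s + h1 s)" if "x \<le> y" for x y
  proof -
    have "set_integrable M {x..<y} f1" "set_integrable M {x..<y} h1"
      using assms by (auto simp: primitive_def intro: set_integrable_atLeastLessThan)
    from set_integral_add(2)[OF this] show ?thesis
      using primitiveD[OF assms(1) that] primitiveD[OF assms(2) that] by simp
  qed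
  then show ?thesis using assms unfolding primitive_def by (auto intro: monotone_difference_add)
qed

lemma primitive_sum:
  "(\<And>i. i \<in> I \<Longrightarrow> primitive (f i) (f1 i)) \<Longrightarrow>
    primitive (\<lambda>s. \<Sum>i\<in>I. f i s) (\<lambda>s. \<Sum>i\<in>I. f1 i s)"
  by (induction I rule: infinite_finite_induct) (auto intro: primitive_add primitive_const)

section \<open>Increments between extended points as integrals\<close>

lemma left_part_diff_sets [measurable]: "left_part q - left_part p \<in> sets borel"
  by (cases p; cases q) auto

lemma left_part_diff_subset: "left_part q - left_part p \<subseteq> {base p..base q}"
  by (cases p; cases q) auto

lemma ext_plus_primitive:
  assumes f: "primitive f f1" and a: "a \<le> base q"
  shows "ext_plus f q - f a = (LINT s:left_part q \<inter> {a..}|M. f1 s)"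
proof (cases q)
  case (Point t)
  have "left_part q \<inter> {a..} = {a..<t}" using Point by auto
  then show ?thesis using f a Point by (simp add: primitive_def)
next
  case (Right t)
  \<comment> \<open>A sequence decreasing strictly to t: the intervals [a,s_n) shrink to [a,t],
    which contains the jump at t.\<close>
  define s where "s n = t + 1 / real (Suc n)" for n
  have "s \<longlonglongrightarrow> t + 0"
    unfolding s_def by (intro tendsto_add tendsto_const LIMSEQ_Suc[OF lim_1_over_n])
  then have s: "filterlim s (at_right t) sequentially"
    unfolding filterlim_at by (auto simp: s_def)
  have "((\<lambda>x. f x - f a) \<longlongrightarrow> ext_plus f q - f a) (at_right t)"
    using f Right unfolding primitive_def
    by (auto intro!: tendsto_diff monotone_difference_tendsto_at_right)
  then have lim: "(\<lambda>n. f (s n) - f a) \<longlonglongrightarrow> ext_plus f q - f a"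
    by (rule filterlim_compose[OF _ s])
  have eq: "f (s n) - f a = (LINT s:{a..<s n}|M. f1 s)" for n
  proof -
    have "t \<le> s n" by (simp add: s_def)
    then show ?thesis using f a Right by (auto simp: primitive_def)
  qed
  have "(\<lambda>n. LINT s:{a..<s n}|M. f1 s) \<longlonglongrightarrow> (LINT s:(\<Inter>n. {a..<s n})|M. f1 s)"
  proof (rule set_integral_cont_down)
    have "s n \<le> s m" if "m \<le> n" for m n
      using that by (simp add: s_def frac_le)
    then show "decseq (\<lambda>n. {a..<s n})"
      unfolding decseq_def by (auto intro: less_le_trans)
    show "set_integrable M {a..<s 0} f1"
      using f by (auto simp: primitive_def intro: set_integrable_atLeastLessThan)
  qed simp
  moreover have "(\<Inter>n. {a..<s n}) = left_part q \<inter> {a..}"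
  proof -
    have "x \<le> t" if "\<And>n. x < s n" for x
    proof (rule LIMSEQ_le_const)
      show "s \<longlonglongrightarrow> t" using \<open>s \<longlonglongrightarrow> t + 0\<close> by simp
      show "\<exists>N. \<forall>n\<ge>N. x \<le> s n" using that less_imp_le by blast
    qed
    moreover have "x < s n" if "x \<le> t" for x n
    proof -
      have "t < s n" by (simp add: s_def)
      with that show ?thesis by simp
    qed
    ultimately show ?thesis using Right by auto
  qed
  ultimately have "(\<lambda>n. f (s n) - f a) \<longlonglongrightarrow> (LINT s:left_part q \<inter> {a..}|M. f1 s)"
    by (simp only: eq)
  then show ?thesis by (rule LIMSEQ_unique[OF lim])
qed

lemma ext_plus_increment:
  assumes f: "primitive f f1" and pq: "left_part p \<subseteq> left_part q"
  shows "ext_plus f q - ext_plus f p = (LINT s:left_part q - left_part p|M. f1 s)"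
proof -
  let ?a = "base p"
  have f1: "monotone_difference f1" using f by (simp add: primitive_def)
  \<comment> \<open>Both extended points are compared with the real point \<open>base p\<close>; to
    the right of it \<open>left_part p\<close> contributes nothing or the single atom.\<close>
  have split: "left_part q \<inter> {?a..} = (left_part p \<inter> {?a..}) \<union> (left_part q - left_part p)"
    using pq left_part_diff_subset[of q p] by auto
  have meas: "left_part p \<inter> {?a..} \<in> sets borel" by (cases p) auto
  have sub: "left_part p \<inter> {?a..} \<subseteq> {?a..?a}" by (cases p) auto
  have "ext_plus f q - f ?a = (LINT s:left_part q \<inter> {?a..}|M. f1 s)"
    by (rule ext_plus_primitive[OF f base_mono[OF pq]])
  also have "\<dots> = (LINT s:left_part p \<inter> {?a..}|M. f1 s) + (LINT s:left_part q - left_part p|M. f1 s)"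
    unfolding split
    by (intro set_integral_Un set_integrable_monotone_difference[OF f1 meas sub]
        set_integrable_monotone_difference[OF f1 left_part_diff_sets left_part_diff_subset]) auto
  also have "(LINT s:left_part p \<inter> {?a..}|M. f1 s) = ext_plus f p - f ?a"
    using ext_plus_primitive[OF f order_refl, of p] by simp
  finally show ?thesis by simp
qed

text \<open>This is the flat stretch of \<open>g\<close> immediately to the left of
  \<open>s\<close>, where nothing has mass.\<close>

lemma null_level_set: "{z. z < s \<and> g s \<le> g z} \<in> null_sets M" (is "?B \<in> _")
proof -
  \<comment> \<open>The stretch may or may not contain its left end. The null intervals starting at
    rational points and at the minimum, if there is one, form a countable cover in both
    cases.\<close>
  let ?C = "{r \<in> ?B. r \<in> \<rat> \<or> (\<forall>z\<in>?B. r \<le> z)}"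
  have null: "{r..<s} \<in> null_sets M" if "r \<in> ?B" for r
    using that emeasure_LS_measure[OF g, of r s] by (intro null_setsI) (auto simp: ennreal_eq_0_iff)
  have "countable {r \<in> ?B. \<forall>z\<in>?B. r \<le> z}"
  proof (rule countable_subset)
    show "{r \<in> ?B. \<forall>z\<in>?B. r \<le> z} \<subseteq> {SOME r. r \<in> ?B \<and> (\<forall>z\<in>?B. r \<le> z)}"
    proof
      fix r assume r: "r \<in> {r \<in> ?B. \<forall>z\<in>?B. r \<le> z}"
      let ?r = "SOME r. r \<in> ?B \<and> (\<forall>z\<in>?B. r \<le> z)"
      have "?r \<in> ?B \<and> (\<forall>z\<in>?B. ?r \<le> z)"
        by (rule someI[of _ r]) (use r in blast)
      with r have "?r \<le> r" "r \<le> ?r" by blast+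
      then show "r \<in> {?r}" by simp
    qed
  qed simp
  moreover have "countable (\<rat> :: real set)" by (rule countable_rat)
  ultimately have "countable ({r \<in> ?B. \<forall>z\<in>?B. r \<le> z} \<union> \<rat>)" by simp
  then have C: "countable ?C" by (rule countable_subset[rotated]) blast
  have "?B = (\<Union>r\<in>?C. {r..<s})"
  proof (intro equalityI subsetI)
    fix z assume z: "z \<in> ?B"
    show "z \<in> (\<Union>r\<in>?C. {r..<s})"
    proof (cases "\<forall>z'\<in>?B. z \<le> z'")
      case True
      then show ?thesis using z by auto
    next
      case False
      then obtain z' where z': "z' \<in> ?B" "z' < z" by force
      obtain r where r: "r \<in> \<rat>" "z' < r" "r < z" using Rats_dense_in_real[OF z'(2)] by blast
      then have "g s \<le> g r" using z' g_le[of z' r] by simp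
      then show ?thesis using r z by (intro UN_I[of r]) auto
    qed
  next
    fix z assume "z \<in> (\<Union>r\<in>?C. {r..<s})"
    then obtain r where "g s \<le> g r" "r \<le> z" "z < s" by auto
    then show "z \<in> ?B" using g_le[of r z] by simp
  qed
  also have "\<dots> \<in> null_sets M"
    using C null by (intro null_sets_UN') auto
  finally show ?thesis .
qed

lemma ext_plus_g_le: "z \<notin> left_part p \<Longrightarrow> ext_plus g p \<le> g z"
proof (cases p)
  case (Point t)
  assume "z \<notin> left_part p"
  then show ?thesis using Point g_le by simp
next
  case (Right t)
  assume "z \<notin> left_part p"
  then have tz: "t < z" using Right by simp
  have "\<forall>\<^sub>F s in at_right t. s < z" using tz eventually_at_right by auto
  then have ev: "\<forall>\<^sub>F s in at_right t. g s \<le> g z"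
    by eventually_elim (simp add: g_le)
  show ?thesis
    using tendsto_upperbound[OF monotone_difference_tendsto_at_right[OF
        monotone_difference_mono[OF mono_g]] ev] Right by simp
qed

text \<open>Mean values must be found where \<open>g\<close> is strictly below its value at
  \<open>q\<close>. The other points are negligible: a flat stretch if \<open>q\<close> is real, and
  none if \<open>q\<close> is s^+, because \<open>s\<close> is a jump.\<close>

lemma null_top_level:
  assumes q: "q \<in> Rplus g"
  shows "{z \<in> left_part q - left_part p. ext_plus g q \<le> g z} \<in> null_sets M" (is "?B \<in> _")
proof (cases q)
  case (Point s)
  have [measurable]: "g \<in> borel_measurable borel" using mono_g by (rule borel_measurable_mono)
  have "?B = (left_part q - left_part p) \<inter> {z. ext_plus g q \<le> g z}" by auto
  also have "\<dots> \<in> sets M"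
    by (intro sets.Int) (auto simp: left_part_diff_sets)
  finally have "?B \<in> sets M" .
  then show ?thesis
    by (rule null_sets_subset[OF null_level_set[of s]]) (use Point in auto)
next
  case (Right s)
  then have "s \<in> jump_points g" using q by (auto simp: Rplus_def)
  then have "g s < ext_plus g q" using Right by (simp add: jump_points_def)
  then have empty: "?B = {}" using Right g_le by fastforce
  show ?thesis unfolding empty by (rule null_sets.empty_sets)
qed

section \<open>The mean value theorem\<close>

sublocale graded_points "Rplus g" "ext_plus g" .

lemma left_part_subset:
  assumes "ext_plus g p < ext_plus g q"
  shows "left_part p \<subseteq> left_part q"
proof (rule ccontr)
  assume "\<not> ?thesis"
  then have "left_part q \<subseteq> left_part p" using left_part_cases by blast
  from ext_plus_increment[OF primitive_g this]
  have "ext_plus g p - ext_plus g q = (LINT s:left_part p - left_part q|M. 1)" .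
  moreover have "(LINT s:left_part p - left_part q|M. 1 :: real) \<ge> 0"
    unfolding set_lebesgue_integral_def by (rule Bochner_Integration.integral_nonneg) simp
  ultimately show False using assms by simp
qed

text \<open>Otherwise \<open>f1\<close> would exceed its average \<open>c\<close> almost everywhere
  on a set of positive measure, whereas \<open>f1 - c\<close> has integral 0 there.\<close>

lemma mean_value_lower:
  assumes f: "primitive f f1" and pq: "p \<in> Rplus g" "q \<in> Rplus g" "ext_plus g p < ext_plus g q"
  shows "\<exists>w\<in>Rplus g. ext_plus g p \<le> ext_plus g w \<and> ext_plus g w < ext_plus g q \<and>
    ext_plus f1 w * (ext_plus g q - ext_plus g p) \<le> ext_plus f q - ext_plus f p"
proof (rule ccontr)
  assume no: "\<not> ?thesis"
  define D where "D = left_part q - left_part p"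
  define d where "d = ext_plus g q - ext_plus g p"
  define c where "c = (ext_plus f q - ext_plus f p) / d"
  have d: "d > 0" using pq by (simp add: d_def)
  note sub = left_part_subset[OF pq(3)]
  have f1: "monotone_difference f1" using f by (simp add: primitive_def)
  have D [measurable]: "D \<in> sets borel" "D \<in> sets M" by (auto simp: D_def left_part_diff_sets)
  have int: "set_integrable M D f1" "set_integrable M D (\<lambda>_. c)"
    unfolding D_def
    by (intro set_integrable_monotone_difference[OF _ left_part_diff_sets left_part_diff_subset]
        f1 monotone_difference_const)+
  have D1: "(LINT s:D|M. 1) = d"
    using ext_plus_increment[OF primitive_g sub] by (simp add: D_def d_def)
  have Df1: "(LINT s:D|M. f1 s) = ext_plus f q - ext_plus f p"
    using ext_plus_increment[OF f sub] by (simp add: D_def)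
  have "(LINT s:D|M. c) = c * d"
    using set_integral_mult_right[of M D c "\<lambda>_. 1"] D1 by simp
  then have zero: "(LINT s:D|M. f1 s - c) = 0"
    using int Df1 d by (simp add: c_def)
  have pos: "f1 z > c" if z: "z \<in> D" "g z < ext_plus g q" for z
  proof -
    have "ext_plus g p \<le> g z" using z by (intro ext_plus_g_le) (simp add: D_def)
    moreover have "Point z \<in> Rplus g" by (simp add: Rplus_def)
    ultimately have "\<not> f1 z * d \<le> ext_plus f q - ext_plus f p"
      using no z(2) by (auto simp: d_def dest!: bspec[of _ _ "Point z"])
    then show ?thesis using d by (simp add: c_def field_simps)
  qed
  have "AE z in M. z \<notin> {z \<in> left_part q - left_part p. ext_plus g q \<le> g z}"
    by (rule AE_not_in[OF null_top_level[OF pq(2)]])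
  then have pos_AE: "AE z in M. z \<in> D \<longrightarrow> f1 z > c"
    by eventually_elim (use pos in \<open>auto simp: D_def\<close>)
  \<comment> \<open>The cutoff by the indicator provides integrability on the whole line, where
    \<open>f1 - c\<close> itself need not be integrable.\<close>
  have "integrable M (\<lambda>z. indicator D z *\<^sub>R (f1 z - c))"
    using set_integral_diff(1)[OF int] by (simp add: set_integrable_def)
  moreover have "(LINT z:D|M. indicator D z *\<^sub>R (f1 z - c)) = 0"
    using zero by (simp add: set_lebesgue_integral_def indicator_inter_arith[symmetric] mult.assoc[symmetric])
  moreover have "AE z\<in>D in M. indicator D z *\<^sub>R (f1 z - c) > 0"
    using pos_AE by eventually_elim simp
  ultimately have "D \<in> null_sets M"
    using D by (intro null_if_pos_func_has_zero_int)
  then have "(LINT s:D|M. 1 :: real) = 0"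
    by (simp add: set_lebesgue_integral_def measure_def null_setsD1)
  with D1 d show False by simp
qed

text \<open>Equal values of \<open>g\<close> mean that the set between the two points is null, so no
  primitive changes across it.\<close>

lemma ext_plus_eq_of_g_eq:
  assumes f: "primitive f f1" and eq: "ext_plus g p = ext_plus g q"
  shows "ext_plus f p = ext_plus f q"
proof -
  have *: "ext_plus f p = ext_plus f q"
    if sub: "left_part p \<subseteq> left_part q" and eq: "ext_plus g p = ext_plus g q" for p q
  proof -
    define D where "D = left_part q - left_part p"
    have D: "D \<in> sets M" by (simp add: D_def left_part_diff_sets)
    have int: "set_integrable M D (\<lambda>_. 1 :: real)"
      unfolding D_def
      by (intro set_integrable_monotone_difference[OF _ left_part_diff_sets left_part_diff_subset]
          monotone_difference_const)
    have "(LINT s:D|M. 1 :: real) = 0"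
      using ext_plus_increment[OF primitive_g sub] eq by (simp add: D_def)
    then have "D \<in> null_sets M"
      using int D by (intro null_if_pos_func_has_zero_int[where f = "indicator D"])
        (auto simp: set_lebesgue_integral_def set_integrable_def indicator_inter_arith[symmetric])
    then have "(LINT s:D|M. f1 s) = 0"
      unfolding set_lebesgue_integral_def
      by (intro integral_eq_zero_AE) (auto dest!: AE_not_in elim!: eventually_mono)
    then show ?thesis using ext_plus_increment[OF f sub] by (simp add: D_def)
  qed
  show ?thesis using left_part_cases[of p q] *[of p q] *[of q p] eq by auto
qed

lemma ext_plus_minus:
  assumes "monotone_difference f"
  shows "ext_plus (\<lambda>s. - f s) z = - ext_plus f z"
  using ext_plus_cmult[OF assms, of "- 1" z] by simp

lemma primitive_has_mean_values:
  assumes f: "primitive f f1"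
  shows "has_mean_values (ext_plus f) (ext_plus f1)"
  unfolding has_mean_values_def
proof (intro ballI conjI impI)
  fix p q assume pq: "p \<in> Rplus g" "q \<in> Rplus g"
  show "ext_plus f p = ext_plus f q" if "ext_plus g p = ext_plus g q"
    by (rule ext_plus_eq_of_g_eq[OF f that])
  assume less: "ext_plus g p < ext_plus g q"
  show "\<exists>w\<in>Rplus g. ext_plus g p \<le> ext_plus g w \<and> ext_plus g w < ext_plus g q \<and>
    ext_plus f1 w * (ext_plus g q - ext_plus g p) \<le> ext_plus f q - ext_plus f p"
    by (rule mean_value_lower[OF f pq less])
  have "monotone_difference f" "monotone_difference f1" using f by (auto simp: primitive_def)
  then show "\<exists>w\<in>Rplus g. ext_plus g p \<le> ext_plus g w \<and> ext_plus g w < ext_plus g q \<and>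
    ext_plus f q - ext_plus f p \<le> ext_plus f1 w * (ext_plus g q - ext_plus g p)"
    using mean_value_lower[OF primitive_minus[OF f] pq less]
    by (simp add: ext_plus_minus) (smt (verit, best) mult_minus_left)
qed

section \<open>Monomials\<close>

text \<open>Division by the factorial removes the factor m from the recursion and leaves iterated
  integrals of 1.\<close>

definition unit_gmonom :: "nat \<Rightarrow> real \<Rightarrow> real \<Rightarrow> real" where
  "unit_gmonom m s x = gmonom_real g m s x / fact m"

lemma monotone_difference_gmonom_real: "monotone_difference (gmonom_real g m s)"
proof (induction m)
  case 0
  have "gmonom_real g 0 s = (\<lambda>_. 1)" by auto
  then show ?case by (simp only: monotone_difference_const)
next
  case (Suc m)
  have "gmonom_real g (Suc m) s = (\<lambda>x. real (Suc m) * LS_integral g s x (gmonom_real g m s))"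
    by auto
  then show ?case
    by (simp only: monotone_difference_cmult[OF monotone_difference_LS_integral[OF Suc]])
qed

lemma monotone_difference_unit_gmonom: "monotone_difference (unit_gmonom m s)"
proof -
  have "unit_gmonom m s = (\<lambda>x. (1 / fact m) * gmonom_real g m s x)"
    by (auto simp: unit_gmonom_def)
  then show ?thesis
    by (simp only: monotone_difference_cmult[OF monotone_difference_gmonom_real])
qed

lemma unit_gmonom_0: "unit_gmonom 0 s x = 1"
  by (simp add: unit_gmonom_def)

lemma unit_gmonom_Suc: "unit_gmonom (Suc m) s x = LS_integral g s x (unit_gmonom m s)"
proof -
  have "unit_gmonom m s = (\<lambda>x. (1 / fact m) * gmonom_real g m s x)"
    by (auto simp: unit_gmonom_def)
  then have "LS_integral g s x (unit_gmonom m s) = (1 / fact m) * LS_integral g s x (gmonom_real g m s)"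
    by (simp only: LS_integral_cmult)
  then show ?thesis
    by (simp add: unit_gmonom_def del: of_nat_Suc)
qed

lemma unit_gmonom_self: "unit_gmonom m s s = (if m = 0 then 1 else 0)"
  by (cases m) (simp_all add: unit_gmonom_0 unit_gmonom_Suc LS_integral_def set_lebesgue_integral_def)

text \<open>The binomial theorem for iterated integrals. In the induction the integral from s to x
  is split at t: the first piece is the term \<open>i = 0\<close>, the second is the earlier formula
  integrated termwise.\<close>

lemma unit_gmonom_recenter:
  "unit_gmonom m s x = (\<Sum>i\<le>m. unit_gmonom (m - i) s t * unit_gmonom i t x)"
proof (induction m arbitrary: x)
  case 0
  then show ?case by (simp add: unit_gmonom_0)
next
  case (Suc m)
  have "unit_gmonom m s = (\<lambda>x. \<Sum>i\<le>m. unit_gmonom (m - i) s t * unit_gmonom i t x)"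
    using Suc by auto
  then have "LS_integral g t x (unit_gmonom m s)
      = LS_integral g t x (\<lambda>x. \<Sum>i\<le>m. unit_gmonom (m - i) s t * unit_gmonom i t x)"
    by simp
  also have "\<dots> = (\<Sum>i\<le>m. unit_gmonom (m - i) s t * unit_gmonom (Suc i) t x)"
    by (subst LS_integral_sum)
      (auto simp: LS_integral_cmult unit_gmonom_Suc
        intro!: monotone_difference_cmult monotone_difference_unit_gmonom)
  finally have "LS_integral g t x (unit_gmonom m s)
      = (\<Sum>i\<le>m. unit_gmonom (m - i) s t * unit_gmonom (Suc i) t x)" .
  moreover have "LS_integral g s x (unit_gmonom m s)
      = LS_integral g s t (unit_gmonom m s) + LS_integral g t x (unit_gmonom m s)"
    by (rule LS_integral_split[OF monotone_difference_unit_gmonom])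
  ultimately have "unit_gmonom (Suc m) s x
      = unit_gmonom (Suc m) s t + (\<Sum>i\<le>m. unit_gmonom (m - i) s t * unit_gmonom (Suc i) t x)"
    by (simp add: unit_gmonom_Suc)
  then show ?case by (simp add: sum.atMost_Suc_shift unit_gmonom_0 del: sum.atMost_Suc)
qed

text \<open>Recentering at \<open>s\<close> itself makes the values at \<open>t\<close> a recursive polynomial expression in the
  monomials centred at \<open>t\<close>; this gives the limit in the centre without dominated convergence.\<close>

lemma unit_gmonom_center_tendsto:
  "\<exists>L. ((\<lambda>s. unit_gmonom m s t) \<longlongrightarrow> L) (at_right t)"
proof (induction m rule: less_induct)
  case (less m)
  have eq: "unit_gmonom m s t
      = (if m = 0 then 1 else 0) - (\<Sum>i<m. unit_gmonom (m - Suc i) s t * unit_gmonom (Suc i) t s)" for s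
    using unit_gmonom_recenter[of m s s t]
    by (simp add: unit_gmonom_self sum.atMost_shift unit_gmonom_0)
  have "\<exists>L. ((\<lambda>s. unit_gmonom (m - Suc i) s t * unit_gmonom (Suc i) t s) \<longlongrightarrow> L) (at_right t)"
    if "i < m" for i
  proof -
    have "m - Suc i < m" using that by simp
    then obtain L where "((\<lambda>s. unit_gmonom (m - Suc i) s t) \<longlongrightarrow> L) (at_right t)"
      using less by blast
    from tendsto_mult[OF this monotone_difference_tendsto_at_right[OF monotone_difference_unit_gmonom]]
    show ?thesis by blast
  qed
  then obtain L where
    "\<And>i. i < m \<Longrightarrow> ((\<lambda>s. unit_gmonom (m - Suc i) s t * unit_gmonom (Suc i) t s) \<longlongrightarrow> L i) (at_right t)"
    by metis
  then have "((\<lambda>s. (if m = 0 then 1 else 0)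
      - (\<Sum>i<m. unit_gmonom (m - Suc i) s t * unit_gmonom (Suc i) t s))
      \<longlongrightarrow> (if m = 0 then 1 else 0) - (\<Sum>i<m. L i)) (at_right t)"
    by (intro tendsto_diff tendsto_const tendsto_sum) auto
  then show ?case unfolding eq[abs_def, symmetric] by blast
qed

section \<open>Monomials with centre in R_+\<close>

definition center_limit :: "real \<Rightarrow> nat \<Rightarrow> real" where
  "center_limit t m = Lim (at_right t) (\<lambda>s. unit_gmonom m s t)"

lemma center_limit: "((\<lambda>s. unit_gmonom m s t) \<longlongrightarrow> center_limit t m) (at_right t)"
  using unit_gmonom_center_tendsto[of m t] tendsto_Lim[OF trivial_limit_at_right_real]
  unfolding center_limit_def by metis

definition ugmonom :: "nat \<Rightarrow> xpoint \<Rightarrow> real \<Rightarrow> real" where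
  "ugmonom m y\<^sub>0 x = gmonom g m y\<^sub>0 (Point x) / fact m"

lemma ugmonom_Point: "ugmonom m (Point s) = unit_gmonom m s"
  by (auto simp: ugmonom_def unit_gmonom_def gmonom_def)

text \<open>Recentering at t confines the moving centre to finitely many coefficients, so the limit
  is taken in these and leaves a combination of monomials centred at t.\<close>

lemma ugmonom_Right:
  "ugmonom m (Right t) x = (\<Sum>i\<le>m. center_limit t (m - i) * unit_gmonom i t x)"
proof -
  have "((\<lambda>s. unit_gmonom m s x) \<longlongrightarrow> (\<Sum>i\<le>m. center_limit t (m - i) * unit_gmonom i t x)) (at_right t)"
    unfolding unit_gmonom_recenter[of m _ x t]
    by (intro tendsto_sum tendsto_mult_right center_limit)
  then have "((\<lambda>s. fact m * unit_gmonom m s x)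
      \<longlongrightarrow> fact m * (\<Sum>i\<le>m. center_limit t (m - i) * unit_gmonom i t x)) (at_right t)"
    by (rule tendsto_mult_left)
  then have "((\<lambda>s. gmonom_real g m s x)
      \<longlongrightarrow> fact m * (\<Sum>i\<le>m. center_limit t (m - i) * unit_gmonom i t x)) (at_right t)"
    by (simp add: unit_gmonom_def)
  from tendsto_Lim[OF trivial_limit_at_right_real this] show ?thesis
    by (simp add: ugmonom_def gmonom_def)
qed

lemma primitive_unit_gmonom: "primitive (unit_gmonom (Suc m) s) (unit_gmonom m s)"
  unfolding primitive_def
proof (intro conjI allI impI monotone_difference_unit_gmonom)
  fix x y :: real assume "x \<le> y"
  moreover have "LS_integral g s y (unit_gmonom m s)
      = LS_integral g s x (unit_gmonom m s) + LS_integral g x y (unit_gmonom m s)"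
    by (rule LS_integral_split[OF monotone_difference_unit_gmonom])
  ultimately show "unit_gmonom (Suc m) s y - unit_gmonom (Suc m) s x = (LINT r:{x..<y}|M. unit_gmonom m s r)"
    by (simp add: unit_gmonom_Suc LS_integral_def)
qed

lemma ugmonom_0: "ugmonom 0 y\<^sub>0 x = 1"
  by (cases y\<^sub>0) (simp_all add: ugmonom_def gmonom_def tendsto_Lim)

lemma primitive_ugmonom: "primitive (ugmonom (Suc m) y\<^sub>0) (ugmonom m y\<^sub>0)"
proof (cases y\<^sub>0)
  case (Point s)
  then show ?thesis by (simp add: ugmonom_Point primitive_unit_gmonom)
next
  case (Right t)
  have "primitive (\<lambda>x. center_limit t (Suc m) * 1
        + (\<Sum>i\<le>m. center_limit t (m - i) * unit_gmonom (Suc i) t x))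
      (\<lambda>x. 0 + (\<Sum>i\<le>m. center_limit t (m - i) * unit_gmonom i t x))"
    by (intro primitive_add primitive_const primitive_sum primitive_cmult primitive_unit_gmonom)
  moreover have "ugmonom (Suc m) y\<^sub>0 = (\<lambda>x. center_limit t (Suc m) * 1
        + (\<Sum>i\<le>m. center_limit t (m - i) * unit_gmonom (Suc i) t x))"
    using Right
    by (auto simp: ugmonom_Right sum.atMost_Suc_shift unit_gmonom_0 simp del: sum.atMost_Suc)
  moreover have "ugmonom m y\<^sub>0 = (\<lambda>x. 0 + (\<Sum>i\<le>m. center_limit t (m - i) * unit_gmonom i t x))"
    using Right by (auto simp: ugmonom_Right)
  ultimately show ?thesis by simp
qed

lemma monotone_difference_ugmonom: "monotone_difference (ugmonom m y\<^sub>0)"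
  using primitive_ugmonom[of m y\<^sub>0] by (simp add: primitive_def)

lemma gmonom_eq_ext_plus: "gmonom g m y\<^sub>0 z / fact m = ext_plus (ugmonom m y\<^sub>0) z"
proof -
  have "gmonom g m y\<^sub>0 z = ext_plus (\<lambda>x. gmonom g m y\<^sub>0 (Point x)) z"
    by (simp add: gmonom_def)
  also have "\<dots> = ext_plus (\<lambda>x. fact m * ugmonom m y\<^sub>0 x) z"
    by (simp add: ugmonom_def)
  also have "\<dots> = fact m * ext_plus (ugmonom m y\<^sub>0) z"
    by (rule ext_plus_cmult[OF monotone_difference_ugmonom])
  finally show ?thesis by simp
qed

text \<open>At t^+ this is an iterated limit, centre first and argument second. The expansion around
  t shows that it agrees with the limit along the diagonal, where monomials are constantly 1 or
  0.\<close>

lemma gmonom_center: "gmonom g m y\<^sub>0 y\<^sub>0 / fact m = (if m = 0 then 1 else 0)"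
proof (cases y\<^sub>0)
  case (Point s)
  then show ?thesis by (simp add: gmonom_eq_ext_plus ugmonom_Point unit_gmonom_self)
next
  case (Right t)
  have lim: "(ugmonom m y\<^sub>0 \<longlongrightarrow> (\<Sum>i\<le>m. center_limit t (m - i) * Lim (at_right t) (unit_gmonom i t))) (at_right t)"
    unfolding Right ugmonom_Right[abs_def]
    by (intro tendsto_sum tendsto_mult_left monotone_difference_tendsto_at_right
        monotone_difference_unit_gmonom)
  have "((\<lambda>s. \<Sum>i\<le>m. unit_gmonom (m - i) s t * unit_gmonom i t s)
      \<longlongrightarrow> (\<Sum>i\<le>m. center_limit t (m - i) * Lim (at_right t) (unit_gmonom i t))) (at_right t)"
    by (intro tendsto_sum tendsto_mult center_limit monotone_difference_tendsto_at_right
        monotone_difference_unit_gmonom)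
  then have "((\<lambda>s. if m = 0 then 1 else 0)
      \<longlongrightarrow> (\<Sum>i\<le>m. center_limit t (m - i) * Lim (at_right t) (unit_gmonom i t))) (at_right t)"
    unfolding unit_gmonom_recenter[symmetric] unit_gmonom_self .
  then have "(\<Sum>i\<le>m. center_limit t (m - i) * Lim (at_right t) (unit_gmonom i t)) = (if m = 0 then 1 else 0)"
    by (rule tendsto_unique[OF trivial_limit_at_right_real _ tendsto_const])
  then show ?thesis
    using tendsto_Lim[OF trivial_limit_at_right_real lim] Right by (simp add: gmonom_eq_ext_plus)
qed

section \<open>Derivatives of combinations of monomials\<close>

lemma ext_plus_gmonom_deriv:
  "gmonom_deriv g y\<^sub>0 j z c = ext_plus (\<lambda>x. if j \<le> c then fact c * ugmonom (c - j) y\<^sub>0 x else 0) z"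
proof (cases "j \<le> c")
  case True
  then show ?thesis
    using ext_plus_cmult[OF monotone_difference_ugmonom, of "fact c" "c - j" y\<^sub>0 z]
    by (simp add: gmonom_deriv_def gmonom_eq_ext_plus)
next
  case False
  then show ?thesis
    by (cases z) (simp_all add: gmonom_deriv_def tendsto_Lim)
qed

lemma primitive_gmonom_deriv:
  "primitive (\<lambda>x. if j \<le> c then fact c * ugmonom (c - j) y\<^sub>0 x else 0)
    (\<lambda>x. if Suc j \<le> c then fact c * ugmonom (c - Suc j) y\<^sub>0 x else 0)"
proof -
  consider "j < c" | "j = c" | "c < j" by linarith
  then show ?thesis
  proof cases
    case 1
    then have "c - j = Suc (c - Suc j)" by simp
    with 1 show ?thesis using primitive_cmult[OF primitive_ugmonom] by simp
  \<comment> \<open>For \<open>j = c\<close> the function is the constant \<open>fact c\<close>, and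
    its derivative is the default 0.\<close>
  qed (simp_all add: ugmonom_0 primitive_const)
qed

lemma Lop_Dop_power_has_mean_values:
  "has_mean_values (Lop g y\<^sub>0 ((Dop ^^ j) l)) (Lop g y\<^sub>0 ((Dop ^^ Suc j) l))" for l :: "real Matrix.vec"
proof -
  let ?\<phi> = "\<lambda>j c x. if j \<le> c then fact c * ugmonom (c - j) y\<^sub>0 x else 0"
  have prim: "primitive (\<lambda>x. l $ c * ?\<phi> j c x) (\<lambda>x. l $ c * ?\<phi> (Suc j) c x)" for j c
    by (rule primitive_cmult[OF primitive_gmonom_deriv])
  have "monotone_difference (?\<phi> j c)" for j c
    using primitive_gmonom_deriv[of j c y\<^sub>0] by (simp only: primitive_def)
  then have ext: "Lop g y\<^sub>0 ((Dop ^^ j) l) = ext_plus (\<lambda>x. \<Sum>c<dim_vec l. l $ c * ?\<phi> j c x)" for j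
    by (intro ext)
      (simp only: Lop_Dop_power ext_plus_sum[OF monotone_difference_cmult] ext_plus_cmult
        ext_plus_gmonom_deriv of_real_eq_id id_apply)
  show ?thesis
    unfolding ext by (intro primitive_has_mean_values primitive_sum prim)
qed

lemma Lop_Dop_power_eq_0: "dim_vec l \<le> j \<Longrightarrow> Lop g y\<^sub>0 ((Dop ^^ j) l) z = 0"
  by (simp add: Lop_Dop_power gmonom_deriv_def)

text \<open>As in Taylor's formula, the values at the centre are the coefficients up to factorials;
  thus vanishing of all derivatives at \<open>y\<^sub>0\<close> gives the zero vector.\<close>

lemma Lop_Dop_power_center:
  fixes l :: "real Matrix.vec"
  assumes "j < dim_vec l"
  shows "Lop g y\<^sub>0 ((Dop ^^ j) l) y\<^sub>0 = fact j * l $ j"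
proof -
  have "gmonom_deriv g y\<^sub>0 j y\<^sub>0 c = (if c = j then fact j else 0)" for c
    unfolding gmonom_deriv_def gmonom_center by simp
  then have "Lop g y\<^sub>0 ((Dop ^^ j) l) y\<^sub>0 = (\<Sum>c<dim_vec l. if c = j then fact j * l $ j else 0)"
    unfolding Lop_Dop_power by (intro sum.cong) auto
  then show ?thesis using assms by simp
qed

section \<open>The homogeneous real problem and the condition on the gaps\<close>

lemma hermite_star_kernel_trivial_iff:
  assumes x: "\<forall>i\<le>k. x i \<in> Rplus g" and le: "\<forall>i<k. ext_plus g (x i) \<le> ext_plus g (x (Suc i))"
    and n: "n = k + (\<Sum>j\<le>k. m j)" and y\<^sub>0: "y\<^sub>0 \<in> Rplus g"
  shows "(\<forall>l :: real Matrix.vec. l \<in> carrier_vec (n + 1) \<longrightarrow>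
      hermite_star_solution g k x m y\<^sub>0 (\<lambda>_ _. 0) l \<longrightarrow> l = 0\<^sub>v (n + 1)) \<longleftrightarrow>
    (\<forall>i<k. card_at_least (ext_plus g ` interval_plus g (x i) (x (Suc i))) (m i + 2))"
    (is "?trivial \<longleftrightarrow> ?many")
proof
  assume many: ?many
  show ?trivial
  proof (intro allI impI)
    fix l :: "real Matrix.vec"
    assume l: "l \<in> carrier_vec (n + 1)" and sol: "hermite_star_solution g k x m y\<^sub>0 (\<lambda>_ _. 0) l"
    have zero: "Lop g y\<^sub>0 ((Dop ^^ j) l) y\<^sub>0 = 0" for j
    proof (rule interpolation_kernel_trivial[where f = "\<lambda>j. Lop g y\<^sub>0 ((Dop ^^ j) l)" and k = k
          and x = x and m = m, OF Lop_Dop_power_has_mean_values _ _ n _ _ y\<^sub>0])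
      show "Lop g y\<^sub>0 ((Dop ^^ j) l) z = 0" if "n < j" for j z
        using that l by (intro Lop_Dop_power_eq_0) simp
      show "x i \<in> Rplus g" if "i \<le> k" for i using x that by blast
      show "card_at_least (ext_plus g ` {z \<in> Rplus g. ext_plus g (x i) \<le> ext_plus g z \<and>
          ext_plus g z \<le> ext_plus g (x (Suc i))}) (m i + 2)" if "i < k" for i
        using many that by (simp add: interval_plus_def)
      show "Lop g y\<^sub>0 ((Dop ^^ j) l) (x r) = 0" if "r \<le> k" "j \<le> m r" for r j
        using sol that by (simp add: hermite_star_solution_def)
    qed
    show "l = 0\<^sub>v (n + 1)"
    proof (rule eq_vecI)
      fix j assume j: "j < dim_vec (0\<^sub>v (n + 1))"
      then have "fact j * l $ j = 0"
        using zero[of j] Lop_Dop_power_center[of j l y\<^sub>0] l by simp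
      then show "l $ j = 0\<^sub>v (n + 1) $ j" using j by simp
    qed (use l in simp)
  qed
next
  assume trivial: ?trivial
  have N: "n + 1 = (\<Sum>r\<le>k. Suc (m r))"
    using n by (simp add: sum_Suc)
  show ?many
  proof (intro allI impI)
    fix i assume i: "i < k"
    let ?B = "ext_plus g ` {z \<in> Rplus g. ext_plus g (x i) \<le> ext_plus g z \<and>
          ext_plus g z \<le> ext_plus g (x (Suc i))}"
    show "card_at_least (ext_plus g ` interval_plus g (x i) (x (Suc i))) (m i + 2)"
    proof (rule ccontr)
      assume "\<not> ?thesis"
      then have B: "finite ?B" "card ?B \<le> Suc (m i)"
        by (auto simp: card_at_least_def interval_plus_def)
      \<comment> \<open>A trivial kernel makes every choice of data solvable. These data demand
        zeros at the left end of the gap and the value 1 at its right end, which the propagation of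
        zeros excludes.\<close>
      define t :: "nat \<Rightarrow> nat \<Rightarrow> real" where "t r j = (if r = Suc i then 1 else 0)" for r j
      obtain l where l: "hermite_star_solution g k x m y\<^sub>0 t l"
        using trivial hermite_star_solution_ex1_iff[OF N, of g x y\<^sub>0 t] by blast
      have "Lop g y\<^sub>0 ((Dop ^^ 0) l) (x (Suc i)) = 0"
      proof (rule zeros_propagate[where f = "\<lambda>j. Lop g y\<^sub>0 ((Dop ^^ j) l)",
            OF Lop_Dop_power_has_mean_values _ _ _ B])
        show "Lop g y\<^sub>0 ((Dop ^^ q) l) (x i) = 0" if "q \<le> m i" for q
          using l that i by (simp add: hermite_star_solution_def t_def)
      qed (use x le i in auto)
      moreover have "Lop g y\<^sub>0 ((Dop ^^ 0) l) (x (Suc i)) = t (Suc i) 0"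
        using l i unfolding hermite_star_solution_def by (metis Suc_leI le0)
      ultimately show False by (simp add: t_def)
    qed
  qed
qed

end

theorem theorem11p15:
  fixes g :: "real \<Rightarrow> real"
    and k n :: nat
    and x :: "nat \<Rightarrow> xpoint"
    and m :: "nat \<Rightarrow> nat"
    and y\<^sub>0 :: xpoint
    and t_real :: "nat \<Rightarrow> nat \<Rightarrow> real"
    and t_complex :: "nat \<Rightarrow> nat \<Rightarrow> complex"
  assumes "derivator g"
    and "\<forall>i\<le>k. x i \<in> Rplus g"
    and "\<forall>i<k. ext_plus g (x i) \<le> ext_plus g (x (Suc i))"
    and "n = k + (\<Sum>j\<le>k. m j)"
    and "y\<^sub>0 \<in> Rplus g"
  shows "((\<exists>!l. l \<in> carrier_vec (n + 1) \<and> hermite_star_solution g k x m y\<^sub>0 t_real l) \<longleftrightarrow>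
           (\<forall>i<k. card_at_least (ext_plus g ` interval_plus g (x i) (x (Suc i))) (m i + 2))) \<and>
         ((\<exists>!l. l \<in> carrier_vec (n + 1) \<and> hermite_star_solution g k x m y\<^sub>0 t_complex l) \<longleftrightarrow>
           (\<forall>i<k. card_at_least (ext_plus g ` interval_plus g (x i) (x (Suc i))) (m i + 2)))"
proof -
  interpret stieltjes g by unfold_locales fact
  have N: "n + 1 = (\<Sum>r\<le>k. Suc (m r))"
    using assms(4) by (simp add: sum_Suc)
  show ?thesis
    unfolding hermite_star_solution_ex1_iff[OF N] hermite_star_kernel_trivial_iff[OF assms(2-5)]
    by simp
qed

end
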